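(* Let $\rho,l>0$ and consider the RBF kernel $k(x,y)=\rho\,e^{-(x-y)^2/(2l^2)}$ on the domain $[0,1]$. Let $n\ge 1$, let $t_1,\dots,t_n\in[0,1]$ be distinct, let $\bm y,\bm F\in\mathbb{R}^n$ and let $\sigma^2,\gamma>0$. Let $\mu(\tau),\Sigma(\tau),\mu'(\tau),\Sigma'(\tau)$ be the exact posterior means and variances of state and derivative at $\tau$ in Gaussian process regression with derivative observations, and let $\tilde\mu(\tau),\tilde\Sigma(\tau),\tilde\mu'(\tau),\tilde\Sigma'(\tau)$ be their approximations obtained from quadrature Fourier features of order $m$ (all defined in the context). Let $$e_{\mathrm{tot}}(\tau):=\max\{|\mu(\tau)-\tilde\mu(\tau)|,\ |\Sigma(\tau)-\tilde\Sigma(\tau)|,\ |\mu'(\tau)-\tilde\mu'(\tau)|,\ |\Sigma'(\tau)-\tilde\Sigma'(\tau)|\}.$$ Let $c:=\min(\gamma,\sigma^2)$ and $R:=\max(\|\bm y\|_\infty,\|\bm F\|_\infty)$, and put $\bar\rho:=\max(\rho,1)$, $\bar l:=\min(l,1)$, $\bar c:=\min(c,1)$, $\bar R:=\max(R,1)$. Let $C>0$. If the integer $m$ satisfies $$m\ \ge\ 3+\max\left(\frac{e}{2\bar l^{\,2}},\ \log_2\!\left(\frac{270\,n^2\bar\rho^{\,3}\bar R}{\bar l^{\,8}\,\bar c^{\,2}\,C}\right)\right),$$ then $e_{\mathrm{tot}}(\tau)\le C$ for all $\tau\in[0,1]$.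
   Context: Exact posterior. Write ${}'k(x,y)=\partial_x k(x,y)$, $k'(x,y)=\partial_y k(x,y)$, $k''(x,y)=\partial_x\partial_y k(x,y)$. Define the $n\times n$ matrices $\bm C,{}'\bm C,\bm C',\bm C''$ with $(i,j)$ entries $k(t_i,t_j)$, ${}'k(t_i,t_j)$, $k'(t_i,t_j)$, $k''(t_i,t_j)$ respectively, and $$\hat{\bm K}=\begin{pmatrix}\bm C&\bm C'\\ {}'\bm C&\bm C''\end{pmatrix}+\begin{pmatrix}\sigma^2 I_n&0\\0&\gamma I_n\end{pmatrix}\in\mathbb{R}^{2n\times 2n}.$$ For $\tau\in[0,1]$ let $\hat{\bm k}(\tau)\in\mathbb{R}^{2n}$ be the concatenation of $(k(t_i,\tau))_{i=1}^n$ and $({}'k(t_i,\tau))_{i=1}^n$, and $\hat{\bm k}'(\tau)\in\mathbb{R}^{2n}$ the concatenation of $(k'(t_i,\tau))_{i=1}^n$ and $(k''(t_i,\tau))_{i=1}^n$. Then $$\mu(\tau)=\hat{\bm k}(\tau)^T\hat{\bm K}^{-1}\begin{pmatrix}\bm y\\ \bm F\end{pmatrix},\quad \mu'(\tau)=\hat{\bm k}'(\tau)^T\hat{\bm K}^{-1}\begin{pmatrix}\bm y\\ \bm F\end{pmatrix},$$ $$\Sigma(\tau)=k(\tau,\tau)-\hat{\bm k}(\tau)^T\hat{\bm K}^{-1}\hat{\bm k}(\tau),\quad \Sigma'(\tau)=k''(\tau,\tau)-\hat{\bm k}'(\tau)^T\hat{\bm K}^{-1}\hat{\bm k}'(\tau).$$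 Quadrature Fourier features of order $m$. Let $\omega_1^m,\dots,\omega_m^m$ and $W_1^m,\dots,W_m^m>0$ be the abscissas and weights of the $m$-point Gauss–Hermite quadrature rule for the weight $e^{-\omega^2}$ on $\mathbb{R}$ (abscissas are the zeros of the Hermite polynomial $H_m$; the rule is exact for polynomials of degree at most $2m-1$). For $t\in\mathbb{R}$ let $\bm\phi(t)\in\mathbb{R}^{2m}$ consist, for each $q=1,\dots,m$, of $\sqrt{\rho/\sqrt\pi}\,\sqrt{W_q^m}\cos(\omega_q^m\tfrac{\sqrt2}{l}t)$ and $\sqrt{\rho/\sqrt\pi}\,\sqrt{W_q^m}\sin(\omega_q^m\tfrac{\sqrt2}{l}t)$, and let $\bm\phi(t)'$ be its derivative in $t$. The approximations $\tilde\mu,\tilde\mu',\tilde\Sigma,\tilde\Sigma'$ are obtained from the formulas above by replacing everywhere $k(x,y)$ by $\bm\phi(x)^T\bm\phi(y)$, ${}'k(x,y)$ by $\bm\phi(x)'^{\,T}\bm\phi(y)$, $k'(x,y)$ by $\bm\phi(x)^T\bm\phi(y)'$ and $k''(x,y)$ by $\bm\phi(x)'^{\,T}\bm\phi(y)'$ (the noise terms $\sigma^2 I_n,\gamma I_n$ are unchanged). *)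

theory Defs
  imports "HOL-Analysis.Analysis" "HOL-Computational_Algebra.Polynomial"
begin

text \<open>A kernel together with its two first partial derivatives and its mixed second one.\<close>

record jet =
  val :: "real \<Rightarrow> real \<Rightarrow> real"
  d1 :: "real \<Rightarrow> real \<Rightarrow> real"
  d2 :: "real \<Rightarrow> real \<Rightarrow> real"
  d12 :: "real \<Rightarrow> real \<Rightarrow> real"

definition kernel_jet :: "(real \<Rightarrow> real \<Rightarrow> real) \<Rightarrow> jet" where
  "kernel_jet k =
    \<lparr> val = k,
      d1 = (\<lambda>x y. deriv (\<lambda>u. k u y) x),
      d2 = (\<lambda>x y. deriv (\<lambda>v. k x v) y),
      d12 = (\<lambda>x y. deriv (\<lambda>u. deriv (\<lambda>v. k u v) y) x) \<rparr>"

definition rbf :: "real \<Rightarrow> real \<Rightarrow> real \<Rightarrow> real \<Rightarrow> real" where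
  "rbf \<rho> l x y = \<rho> * exp (- (x - y)\<^sup>2 / (2 * l\<^sup>2))"

text \<open>
  Vectors of length $2n$ and $2n \times 2n$ matrices are indexed by the sum type, the left
  summand being the state block and the right summand the derivative block.
\<close>

definition block_vec :: "real ^ 'n \<Rightarrow> real ^ 'n \<Rightarrow> real ^ ('n + 'n)" where
  "block_vec u v = (\<chi> r. case r of Inl i \<Rightarrow> u $ i | Inr i \<Rightarrow> v $ i)"

definition block_mat ::
  "real ^ 'n ^ 'n \<Rightarrow> real ^ 'n ^ 'n \<Rightarrow> real ^ 'n ^ 'n \<Rightarrow> real ^ 'n ^ 'n
    \<Rightarrow> real ^ ('n + 'n) ^ ('n + 'n)" where
  "block_mat A B C D = (\<chi> r s. case r of
      Inl i \<Rightarrow> (case s of Inl j \<Rightarrow> A $ i $ j | Inr j \<Rightarrow> B $ i $ j)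
    | Inr i \<Rightarrow> (case s of Inl j \<Rightarrow> C $ i $ j | Inr j \<Rightarrow> D $ i $ j))"

definition gram :: "(real \<Rightarrow> real \<Rightarrow> real) \<Rightarrow> real ^ 'n \<Rightarrow> real ^ 'n ^ 'n" where
  "gram f t = (\<chi> i j. f (t $ i) (t $ j))"

text \<open>In what follows \<open>s\<close> and \<open>\<gamma>\<close> are the two noise variances.\<close>

definition K_hat :: "jet \<Rightarrow> real ^ 'n \<Rightarrow> real \<Rightarrow> real \<Rightarrow> real ^ ('n + 'n) ^ ('n + 'n)" where
  "K_hat J t s \<gamma> =
     block_mat (gram (val J) t) (gram (d2 J) t) (gram (d1 J) t) (gram (d12 J) t)
     + block_mat (mat s) 0 0 (mat \<gamma>)"

definition k_hat :: "jet \<Rightarrow> real ^ 'n \<Rightarrow> real \<Rightarrow> real ^ ('n + 'n)" where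
  "k_hat J t \<tau> = block_vec (\<chi> i. val J (t $ i) \<tau>) (\<chi> i. d1 J (t $ i) \<tau>)"

definition k_hat' :: "jet \<Rightarrow> real ^ 'n \<Rightarrow> real \<Rightarrow> real ^ ('n + 'n)" where
  "k_hat' J t \<tau> = block_vec (\<chi> i. d2 J (t $ i) \<tau>) (\<chi> i. d12 J (t $ i) \<tau>)"

definition post_mean ::
  "jet \<Rightarrow> real ^ 'n \<Rightarrow> real \<Rightarrow> real \<Rightarrow> real ^ 'n \<Rightarrow> real ^ 'n \<Rightarrow> real \<Rightarrow> real" where
  "post_mean J t s \<gamma> y F \<tau> =
     k_hat J t \<tau> \<bullet> (matrix_inv (K_hat J t s \<gamma>) *v block_vec y F)"

definition post_mean' ::
  "jet \<Rightarrow> real ^ 'n \<Rightarrow> real \<Rightarrow> real \<Rightarrow> real ^ 'n \<Rightarrow> real ^ 'n \<Rightarrow> real \<Rightarrow> real" where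
  "post_mean' J t s \<gamma> y F \<tau> =
     k_hat' J t \<tau> \<bullet> (matrix_inv (K_hat J t s \<gamma>) *v block_vec y F)"

definition post_var :: "jet \<Rightarrow> real ^ 'n \<Rightarrow> real \<Rightarrow> real \<Rightarrow> real \<Rightarrow> real" where
  "post_var J t s \<gamma> \<tau> =
     val J \<tau> \<tau> - k_hat J t \<tau> \<bullet> (matrix_inv (K_hat J t s \<gamma>) *v k_hat J t \<tau>)"

definition post_var' :: "jet \<Rightarrow> real ^ 'n \<Rightarrow> real \<Rightarrow> real \<Rightarrow> real \<Rightarrow> real" where
  "post_var' J t s \<gamma> \<tau> =
     d12 J \<tau> \<tau> - k_hat' J t \<tau> \<bullet> (matrix_inv (K_hat J t s \<gamma>) *v k_hat' J t \<tau>)"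

text \<open>Physicists' Hermite polynomials, orthogonal for the weight $e^{-x^2}$.\<close>

primrec hermite :: "nat \<Rightarrow> real poly" where
  "hermite 0 = 1"
| "hermite (Suc m) = [:0, 2:] * hermite m - pderiv (hermite m)"

lemma hermite_Rodrigues:
  "(deriv ^^ m) (\<lambda>x::real. exp (- x\<^sup>2))
     = (\<lambda>x. (- 1) ^ m * poly (hermite m) x * exp (- x\<^sup>2))"
proof (induction m)
  case 0
  show ?case by simp
next
  case (Suc m)
  have "((\<lambda>x. (- 1) ^ m * poly (hermite m) x * exp (- x\<^sup>2)) has_real_derivative
          (- 1) ^ Suc m * poly (hermite (Suc m)) x * exp (- x\<^sup>2)) (at x)" for x :: real
    by (auto intro!: derivative_eq_intros simp: algebra_simps)
  then show ?case
    unfolding funpow.simps comp_def Suc.IH by (intro ext DERIV_imp_deriv)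
qed

text \<open>
  The abscissas \<open>\<omega> 0, \<dots>, \<omega> (m - 1)\<close> enumerate the zeros of the Hermite polynomial without
  repetition.
\<close>

definition gauss_hermite :: "nat \<Rightarrow> (nat \<Rightarrow> real) \<Rightarrow> (nat \<Rightarrow> real) \<Rightarrow> bool" where
  "gauss_hermite m \<omega> W \<longleftrightarrow>
     bij_betw \<omega> {..<m} {x. poly (hermite m) x = 0} \<and>
     (\<forall>q<m. W q > 0) \<and>
     (\<forall>p :: real poly. degree p < 2 * m \<longrightarrow>
        has_bochner_integral lborel (\<lambda>x. exp (- x\<^sup>2) * poly p x)
          (\<Sum>q<m. W q * poly p (\<omega> q)))"

text \<open>
  Component \<open>i < 2 * m\<close> of the feature vector: the cosine of frequency \<open>q\<close> sits at \<open>i = 2 * q\<close>,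
  the sine at \<open>i = 2 * q + 1\<close>.
\<close>

definition qff :: "(nat \<Rightarrow> real) \<Rightarrow> (nat \<Rightarrow> real) \<Rightarrow> real \<Rightarrow> real \<Rightarrow> real \<Rightarrow> nat \<Rightarrow> real" where
  "qff \<omega> W \<rho> l t i =
     sqrt (\<rho> / sqrt pi) * sqrt (W (i div 2)) *
       (if even i then cos (\<omega> (i div 2) * (sqrt 2 / l) * t)
        else sin (\<omega> (i div 2) * (sqrt 2 / l) * t))"

definition feature_jet :: "nat \<Rightarrow> (real \<Rightarrow> nat \<Rightarrow> real) \<Rightarrow> jet" where
  "feature_jet N \<phi> = (let \<phi>' = (\<lambda>t i. deriv (\<lambda>u. \<phi> u i) t) in
    \<lparr> val = (\<lambda>x y. \<Sum>i<N. \<phi> x i * \<phi> y i),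
      d1 = (\<lambda>x y. \<Sum>i<N. \<phi>' x i * \<phi> y i),
      d2 = (\<lambda>x y. \<Sum>i<N. \<phi> x i * \<phi>' y i),
      d12 = (\<lambda>x y. \<Sum>i<N. \<phi>' x i * \<phi>' y i) \<rparr>)"

definition e_tot ::
  "jet \<Rightarrow> jet \<Rightarrow> real ^ 'n \<Rightarrow> real \<Rightarrow> real \<Rightarrow> real ^ 'n \<Rightarrow> real ^ 'n \<Rightarrow> real \<Rightarrow> real" where
  "e_tot J J' t s \<gamma> y F \<tau> = Max
    { \<bar>post_mean J t s \<gamma> y F \<tau> - post_mean J' t s \<gamma> y F \<tau>\<bar>,
      \<bar>post_var J t s \<gamma> \<tau> - post_var J' t s \<gamma> \<tau>\<bar>,
      \<bar>post_mean' J t s \<gamma> y F \<tau> - post_mean' J' t s \<gamma> y F \<tau>\<bar>,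
      \<bar>post_var' J t s \<gamma> \<tau> - post_var' J' t s \<gamma> \<tau>\<bar> }"

end

theory Submission
  imports Defs "HOL-Probability.Characteristic_Functions" "HOL-Real_Asymp.Real_Asymp"
begin

text \<open>
  Both kernels are integrals of the same trigonometric functions of the frequency, against the
  Gaussian for the RBF kernel and against the quadrature nodes for the features. Hence both Gram
  matrices are positive semidefinite, the two regularised matrices have inverses of norm at most
  $1/c$, and it suffices to bound the entrywise errors of the kernel and its derivatives.

  The derivatives put factors $w$ and $w^2$ in front of $\sin (b w)$ and $\cos (b w)$, whose higher
  derivatives are unbounded. With $k = m - 2$, only the trigonometric factor is interpolated,
  doubly at the zeros of $H_k$. Its interpolant, times $w^2$, still has degree less than $2m$ and is
  integrated exactly, while the remainder is at most $b^{2k} h_k(w)^2 / (2k)!$ with $h_k$ the monic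
  multiple of $H_k$, and $(1 + w^2) h_k^2$ is again integrated exactly.
\<close>

section \<open>Hermite interpolation\<close>

text \<open>The nodes must be real and distinct. For \<open>hermite k\<close> this is drawn from the
  rule itself: \<open>gauss_hermite\<close> supplies m distinct real zeros of H_m, and because
  H_(n+1)' is a multiple of H_n, Rolle's theorem passes the property down to H_(m-2). The choice k =
  m - 2 is the largest possible one: (1 + w^2) h_k^2 has degree 2k + 2, which must stay below 2m.
  The constants of the theorem arise as follows. Put L = 1/lb^2. From (2k)!/k! >= (4k/e)^k the
  quadrature error acquires the factor (eL/(2k))^k / 2^k, so e/(2 lb^2) is the threshold beyond
  which it decays like 2^-k. Each kernel entry is then off by at most 60 \<rho>b L^2 / 2^m, and the
  posterior magnifies this by 9 n^2 (\<rho>b L)^2 Rb / cb^2. Here 9 * 60 = 2 * 270, and L^4 is the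
  power 8 of lb. The summand 3 gives 2^m >= 8X for the argument X of the logarithm, which even
  leaves C/4.\<close>

lemma Rolle_interleave:
  fixes f f' :: "real \<Rightarrow> real"
  assumes der: "\<And>x. (f has_real_derivative f' x) (at x)"
    and "finite S" "card S = Suc k" "\<And>x. x \<in> S \<Longrightarrow> f x = 0"
  shows "\<exists>T. finite T \<and> card T = k \<and> T \<inter> S = {} \<and> (\<forall>x\<in>T. f' x = 0)
    \<and> (\<forall>x\<in>T. x < Max S)"
  using assms(2-)
proof (induction k arbitrary: S)
  case 0
  show ?case by (intro exI[of _ "{}"]) auto
next
  case (Suc k)
  define b where "b = Max S"
  define S' where "S' = S - {b}"
  have bS: "b \<in> S" using Suc.prems unfolding b_def by (intro Max_in) auto
  have S': "finite S'" "card S' = Suc k" "S' \<noteq> {}"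
  proof -
    show "card S' = Suc k" using Suc.prems bS by (simp add: S'_def)
    then show "S' \<noteq> {}" by auto
  qed (use Suc.prems in \<open>auto simp: S'_def\<close>)
  define a where "a = Max S'"
  have aS: "a \<in> S'" using S' unfolding a_def by (intro Max_in) auto
  have le: "x \<le> a" if "x \<in> S'" for x using S' that by (auto simp: a_def)
  have leb: "x \<le> b" if "x \<in> S" for x using Suc.prems that by (auto simp: b_def)
  have "a < b" using aS leb[of a] by (auto simp: S'_def less_le)
  \<comment> \<open>The bound by the maximum is carried along for this step: the earlier zeros lie
    below \<open>a\<close>, so they differ from \<open>b\<close> and from the new zero found between
    \<open>a\<close> and \<open>b\<close>.\<close>
  obtain T where T: "finite T" "card T = k" "T \<inter> S' = {}" "\<forall>x\<in>T. f' x = 0" "\<forall>x\<in>T. x < a"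
    using Suc.IH[of S'] S' Suc.prems by (auto simp: S'_def a_def)
  have "\<exists>z. a < z \<and> z < b \<and> f' z = 0"
  proof -
    have "f a = f b" using Suc.prems aS bS by (auto simp: S'_def)
    moreover have "continuous_on {a..b} f"
      using der by (meson DERIV_continuous continuous_at_imp_continuous_on)
    ultimately obtain z where z: "a < z" "z < b" "DERIV f z :> 0"
      using Rolle[OF \<open>a < b\<close>] der real_differentiable_def by metis
    then have "f' z = 0" using der DERIV_unique by blast
    then show ?thesis using z by blast
  qed
  then obtain z where z: "a < z" "z < b" "f' z = 0" by blast
  have zS: "z \<notin> S" using z le[of z] by (auto simp: S'_def)
  have zT: "z \<notin> T" using z T(5) by auto
  have "b \<notin> T" using T(5) \<open>a < b\<close> by auto
  then have "T \<inter> S = {}" using T(3) by (auto simp: S'_def)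
  then show ?case
    using T z zS zT \<open>a < b\<close> unfolding b_def[symmetric]
    by (intro exI[of _ "insert z T"]) auto
qed

text \<open>Every differentiation costs one zero. The derivatives are given as a chain
  \<open>F\<close>, and the starting index \<open>j\<close> is free because the interpolation
  argument enters the chain at the first derivative.\<close>

lemma Rolle_iterated:
  fixes F :: "nat \<Rightarrow> real \<Rightarrow> real"
  assumes "\<And>j x. (F j has_real_derivative F (Suc j) x) (at x)"
    and "finite S" "card S = Suc k" "\<And>x. x \<in> S \<Longrightarrow> F j x = 0"
  shows "\<exists>\<xi>. F (j + k) \<xi> = 0"
  using assms(2-)
proof (induction k arbitrary: S j)
  case 0
  then show ?case by (metis Nat.add_0_right card_1_singletonE insertI1 One_nat_def)
next
  case (Suc k)
  obtain T where "finite T" "card T = Suc k" "\<forall>x\<in>T. F (Suc j) x = 0"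
    using Rolle_interleave[OF assms(1) Suc.prems] by blast
  then show ?case using Suc.IH[of T "Suc j"] by simp
qed

definition node_poly :: "real set \<Rightarrow> real poly" where
  "node_poly S = (\<Prod>s\<in>S. [:- s, 1:])"

lemma poly_node_poly_eq_0_iff: "finite S \<Longrightarrow> poly (node_poly S) x = 0 \<longleftrightarrow> x \<in> S"
  by (auto simp: node_poly_def poly_prod)

lemma degree_node_poly: "degree (node_poly S) = card S"
  by (simp add: node_poly_def degree_prod_eq_sum_degree)

lemma lead_coeff_node_poly: "lead_coeff (node_poly S) = 1"
  by (simp add: node_poly_def lead_coeff_prod)

lemma poly_pderiv_node_poly_sq:
  assumes "finite S" "x \<in> S"
  shows "poly (pderiv ((node_poly S)\<^sup>2 * q)) x = 0"
proof -
  have "poly (node_poly S) x = 0" using assms by (simp add: poly_node_poly_eq_0_iff)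
  then show ?thesis by (simp add: pderiv_mult power2_eq_square)
qed

text \<open>The form with \<open>coeff p n\<close> instead of the leading coefficient also covers
  polynomials of smaller degree, whose n-th derivative is 0.\<close>

lemma higher_pderiv_degree:
  fixes p :: "real poly"
  assumes "degree p \<le> n"
  shows "(pderiv ^^ n) p = [:fact n * coeff p n:]"
proof (rule poly_eqI)
  fix i
  show "coeff ((pderiv ^^ n) p) i = coeff [:fact n * coeff p n:] i"
    using assms by (cases i) (auto simp: coeff_higher_pderiv pochhammer_fact coeff_eq_0)
qed

text \<open>Newton's construction: a new node is served by adding the squared node polynomial times
  a linear factor, which vanishes to second order at the old nodes and leaves their conditions
  intact. The disjunct \<open>p = 0\<close> is there for the empty set, where no degree is below
  0.\<close>

lemma hermite_interpolant_exists:
  fixes f f' :: "real \<Rightarrow> real"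
  assumes "finite S"
  shows "\<exists>p. (p = 0 \<or> degree p < 2 * card S) \<and>
    (\<forall>s\<in>S. poly p s = f s \<and> poly (pderiv p) s = f' s)"
  using assms
proof (induction S rule: finite_induct)
  case empty
  then show ?case by auto
next
  case (insert x S)
  then obtain p where p: "p = 0 \<or> degree p < 2 * card S"
    "\<And>s. s \<in> S \<Longrightarrow> poly p s = f s \<and> poly (pderiv p) s = f' s" by blast
  define h where "h = node_poly S"
  have hx: "poly h x \<noteq> 0" using insert by (simp add: h_def poly_node_poly_eq_0_iff)
  have dh: "degree (h\<^sup>2) = 2 * card S"
    using lead_coeff_node_poly[of S] by (subst degree_power_eq) (auto simp: h_def degree_node_poly)
  \<comment> \<open>The linear factor is A + B (z - x), expanded in powers of z: \<open>A\<close>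
    corrects the value at \<open>x\<close>, and \<open>B\<close> then corrects the slope.\<close>
  define A where "A = (f x - poly p x) / (poly h x)\<^sup>2"
  define B where "B = (f' x - poly (pderiv p) x - poly (pderiv (h\<^sup>2)) x * A) / (poly h x)\<^sup>2"
  define r where "r = p + h\<^sup>2 * [:A - B * x, B:]"
  have "degree (h\<^sup>2 * [:A - B * x, B:]) \<le> 2 * card S + 1"
    by (rule order_trans[OF degree_mult_le]) (simp add: dh)
  then have "degree r < 2 * card (insert x S)"
    using p(1) insert unfolding r_def by (intro degree_add_less) auto
  moreover have "poly r s = f s \<and> poly (pderiv r) s = f' s" if "s \<in> insert x S" for s
  proof (cases "s = x")
    case True
    have "poly r x = poly p x + (poly h x)\<^sup>2 * A" by (simp add: r_def algebra_simps)
    then have "poly r x = f x" using hx by (simp add: A_def)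
    moreover have "poly (pderiv r) x = f' x"
    proof -
      have "poly (pderiv r) x = poly (pderiv p) x + poly (pderiv (h\<^sup>2)) x * A + (poly h x)\<^sup>2 * B"
        by (simp add: r_def pderiv_add pderiv_mult pderiv_pCons pderiv_smult algebra_simps)
      then show ?thesis using hx by (simp add: B_def)
    qed
    ultimately show ?thesis using True by simp
  next
    case False
    then have "s \<in> S" using that by auto
    have "poly h s = 0"
      using \<open>s \<in> S\<close> insert.hyps by (simp add: h_def poly_node_poly_eq_0_iff)
    moreover have "poly (pderiv (h\<^sup>2 * [:A - B * x, B:])) s = 0"
      unfolding h_def by (rule poly_pderiv_node_poly_sq) fact+
    ultimately show ?thesis
      using p(2)[OF \<open>s \<in> S\<close>] unfolding r_def pderiv_add poly_add poly_mult poly_power by simp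
  qed
  ultimately show ?case by blast
qed

text \<open>The classical remainder argument. For fixed x subtract c h^2 as well, with c chosen so
  that the error also vanishes at x. This difference \<open>G\<close> has one zero more than there
  are nodes, so its derivative vanishes between them and, by double interpolation, at the nodes too.
  These 2 \<open>card S\<close> zeros lead by Rolle to a zero of the derivative of order 2
  \<open>card S\<close>, in which only c (2 \<open>card S\<close>)! is left of the
  polynomials.\<close>

lemma hermite_interpolation_error:
  fixes F :: "nat \<Rightarrow> real \<Rightarrow> real"
  assumes der: "\<And>j x. (F j has_real_derivative F (Suc j) x) (at x)"
    and S: "finite S"
    and B: "\<And>x. \<bar>F (2 * card S) x\<bar> \<le> B"
  shows "\<exists>p. (p = 0 \<or> degree p < 2 * card S) \<and>
    (\<forall>x. \<bar>F 0 x - poly p x\<bar> \<le> B / fact (2 * card S) * (poly (node_poly S) x)\<^sup>2)"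
proof -
  let ?n = "2 * card S"
  define h where "h = node_poly S"
  obtain p where p: "p = 0 \<or> degree p < ?n"
    "\<And>s. s \<in> S \<Longrightarrow> poly p s = F 0 s \<and> poly (pderiv p) s = F 1 s"
    using hermite_interpolant_exists[OF S, of "F 0" "F 1"] by blast
  have h0: "poly h s = 0" if "s \<in> S" for s using S that by (simp add: h_def poly_node_poly_eq_0_iff)
  have dh: "degree (h\<^sup>2) = ?n"
    using lead_coeff_node_poly[of S] by (subst degree_power_eq) (auto simp: h_def degree_node_poly)
  have lh: "coeff (h\<^sup>2) ?n = 1"
    using lead_coeff_node_poly[of S] lead_coeff_power[of h 2] dh by (simp add: h_def)
  have cp: "coeff p ?n = 0" "degree p \<le> ?n" using p(1) by (auto simp: coeff_eq_0)
  have "\<bar>F 0 x - poly p x\<bar> \<le> B / fact ?n * (poly h x)\<^sup>2" for x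
  proof (cases "x \<in> S")
    case True
    then show ?thesis using p(2)[of x] h0 by simp
  next
    case False
    then have hx: "poly h x \<noteq> 0" using S by (simp add: h_def poly_node_poly_eq_0_iff)
    define c where "c = (F 0 x - poly p x) / (poly h x)\<^sup>2"
    define r where "r = p + smult c (h\<^sup>2)"
    define G where "G = (\<lambda>j z. F j z - poly ((pderiv ^^ j) r) z)"
    have dG: "(G j has_real_derivative G (Suc j) z) (at z)" for j z
      unfolding G_def by (auto intro!: derivative_eq_intros der)
    have dr: "(pderiv ^^ ?n) r = [:fact ?n * c:]"
      using cp dh lh by (subst higher_pderiv_degree) (auto simp: r_def intro!: degree_add_le)
    have "G 0 z = 0" if "z \<in> insert x S" for z
      using that hx p(2)[of z] h0 by (auto simp: G_def r_def c_def poly_power)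
    then obtain T where T: "finite T" "card T = card S" "T \<inter> insert x S = {}" "\<forall>z\<in>T. G 1 z = 0"
      using Rolle_interleave[OF dG[of 0], of "insert x S" "card S"] S False by auto
    have G1: "G 1 z = 0" if "z \<in> S \<union> T" for z
    proof (cases "z \<in> T")
      case True
      then show ?thesis using T by blast
    next
      case False
      then have "z \<in> S" using that by blast
      then show ?thesis
        using p(2)[of z] poly_pderiv_node_poly_sq[OF S, of z 1]
        by (simp add: G_def r_def pderiv_add pderiv_smult h_def)
    qed
    have "\<exists>\<xi>. G ?n \<xi> = 0"
    \<comment> \<open>Without nodes \<open>?n\<close> is 0 and \<open>x\<close> itself is the
      required zero. Otherwise the chain is entered at \<open>G 1\<close>, whose 2k + 2 zeros allow
      2k + 1 steps.\<close>
    proof (cases "card S")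
      case 0
      then have "G 0 x = 0" using hx by (simp add: G_def r_def c_def poly_power)
      then show ?thesis using 0 by auto
    next
      case (Suc k)
      have "card (S \<union> T) = Suc (2 * k + 1)"
        using T S Suc by (subst card_Un_disjoint) auto
      then obtain \<xi> where "G (1 + (2 * k + 1)) \<xi> = 0"
        using Rolle_iterated[of G "S \<union> T" "2 * k + 1" 1] dG G1 T S by auto
      then show ?thesis using Suc by (intro exI[of _ \<xi>]) simp
    qed
    then obtain \<xi> where "G ?n \<xi> = 0" by blast
    then have "F ?n \<xi> = fact ?n * c" unfolding G_def dr by simp
    then have "\<bar>fact ?n * c\<bar> \<le> B" using B[of \<xi>] by simp
    then have "\<bar>c\<bar> \<le> B / fact ?n" by (simp add: abs_mult field_simps)
    moreover have "\<bar>F 0 x - poly p x\<bar> = \<bar>c\<bar> * (poly h x)\<^sup>2"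
      using hx by (simp add: c_def abs_divide)
    ultimately show ?thesis
      unfolding h_def by (metis mult_right_mono zero_le_power2)
  qed
  then show ?thesis using p(1) unfolding h_def by blast
qed

section \<open>Hermite polynomials and Gaussian integrals\<close>

lemma degree_hermite: "degree (hermite k) \<le> k"
proof (induction k)
  case (Suc k)
  have "degree ([:0, 2:] * hermite k) \<le> Suc k"
    by (rule order_trans[OF degree_mult_le]) (use Suc in auto)
  moreover have "degree (pderiv (hermite k)) \<le> Suc k" using Suc by (simp add: degree_pderiv)
  ultimately show ?case by (simp add: degree_diff_le)
qed simp

lemma coeff_hermite: "coeff (hermite k) k = 2 ^ k"
proof (induction k)
  case (Suc k)
  have "coeff (pderiv (hermite k)) (Suc k) = 0"
    using degree_hermite[of k] by (intro coeff_eq_0) (simp add: degree_pderiv)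
  then show ?case using Suc by simp
qed simp

text \<open>The Appell property, obtained by differentiating the recurrence: the induction
  hypothesis makes its last two terms a multiple of the recurrence one degree lower. It is what lets
  zeros of H_(k+1) produce zeros of H_k.\<close>

lemma pderiv_hermite: "pderiv (hermite (Suc k)) = smult (2 * real (Suc k)) (hermite k)"
proof (induction k)
  case 0
  show ?case by (simp add: pderiv_diff pderiv_mult pderiv_pCons)
next
  case (Suc k)
  have "pderiv (hermite (Suc (Suc k))) = [:2:] * hermite (Suc k) + [:0, 2:] * pderiv (hermite (Suc k))
      - pderiv (pderiv (hermite (Suc k)))"
    by (simp only: hermite.simps pderiv_diff pderiv_add pderiv_mult) (simp add: pderiv_pCons algebra_simps)
  also have "\<dots> = [:2:] * hermite (Suc k)
      + smult (2 * real (Suc k)) ([:0, 2:] * hermite k - pderiv (hermite k))"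
    unfolding Suc by (simp add: pderiv_smult smult_diff_right)
  also have "\<dots> = smult (2 * real (Suc (Suc k))) (hermite (Suc k))"
    by (simp only: hermite.simps(2)[symmetric]) (simp add: smult_add_left[symmetric] del: hermite.simps)
  finally show ?case .
qed

text \<open>Both sides have the same coefficient at degree k, so a nonzero difference would have
  degree below k and yet vanish at the k points of \<open>S\<close>.\<close>

lemma hermite_eq_node_poly:
  assumes "finite S" "card S = k" "\<And>x. x \<in> S \<Longrightarrow> poly (hermite k) x = 0"
  shows "hermite k = smult (2 ^ k) (node_poly S)"
proof -
  define d where "d = hermite k - smult (2 ^ k) (node_poly S)"
  have c: "coeff d k = 0"
    using lead_coeff_node_poly[of S] assms(2) by (simp add: d_def coeff_hermite degree_node_poly)
  have deg: "degree d \<le> k"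
    using assms(2) degree_hermite by (auto simp: d_def degree_node_poly intro!: degree_diff_le)
  have "d = 0"
  proof (rule ccontr)
    assume d: "d \<noteq> 0"
    then have "degree d < k" using c deg by (metis leading_coeff_0_iff order_le_less)
    moreover have "S \<subseteq> {x. poly d x = 0}"
      using assms by (auto simp: d_def poly_node_poly_eq_0_iff)
    then have "card S \<le> card {x. poly d x = 0}"
      using d by (intro card_mono) (auto simp: poly_roots_finite)
    moreover have "card {x. poly d x = 0} \<le> degree d" using d by (rule card_poly_roots_bound)
    ultimately show False using assms(2) by linarith
  qed
  then show ?thesis by (simp add: d_def)
qed

text \<open>One application of Rolle per degree: the zeros that it finds for the derivative of
  \<open>hermite (Suc n)\<close> are zeros of \<open>hermite n\<close> by
  \<open>pderiv_hermite\<close>.\<close>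

lemma hermite_real_rooted_descent:
  assumes "\<exists>S. finite S \<and> card S = k + j \<and> (\<forall>x\<in>S. poly (hermite (k + j)) x = 0)"
  shows "\<exists>S. finite S \<and> card S = k \<and> (\<forall>x\<in>S. poly (hermite k) x = 0)"
  using assms
proof (induction j)
  case (Suc j)
  then obtain S where S: "finite S" "card S = Suc (k + j)" "\<forall>x\<in>S. poly (hermite (Suc (k + j))) x = 0"
    by auto
  have "\<exists>T. finite T \<and> card T = k + j \<and> T \<inter> S = {}
      \<and> (\<forall>x\<in>T. poly (pderiv (hermite (Suc (k + j)))) x = 0) \<and> (\<forall>x\<in>T. x < Max S)"
    by (rule Rolle_interleave[OF poly_DERIV]) (use S in auto)
  then have "\<exists>T. finite T \<and> card T = k + j \<and> (\<forall>x\<in>T. poly (hermite (k + j)) x = 0)"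
    unfolding pderiv_hermite by (auto simp del: hermite.simps)
  then show ?case by (rule Suc.IH)
qed simp

section \<open>Integration against the Gaussian weight\<close>

definition gint :: "(real \<Rightarrow> real) \<Rightarrow> real" where
  "gint f = (LBINT x. exp (- x\<^sup>2) * f x)"

abbreviation gintegrable :: "(real \<Rightarrow> real) \<Rightarrow> bool" where
  "gintegrable f \<equiv> integrable lborel (\<lambda>x. exp (- x\<^sup>2) * f x)"

lemma gintegrable_power: "gintegrable (\<lambda>x. x ^ k)"
proof -
  have "integrable lborel (\<lambda>x. normal_density 0 (1 / sqrt 2) x * (x - 0) ^ k)"
    by (rule integrable_normal_moment) simp
  then have "integrable lborel (\<lambda>x. sqrt pi * (normal_density 0 (1 / sqrt 2) x * (x - 0) ^ k))"
    by (rule integrable_mult_right)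
  then show ?thesis
    by (simp add: normal_density_def power_divide real_sqrt_divide)
qed

lemma gintegrable_poly: "gintegrable (poly p)"
  unfolding poly_altdef sum_distrib_left
  by (intro Bochner_Integration.integrable_sum)
    (use integrable_mult_right[OF gintegrable_power] in \<open>simp add: mult.left_commute\<close>)

lemma gintegrable_dominated:
  fixes f :: "real \<Rightarrow> real"
  assumes "f \<in> borel_measurable borel" "\<And>x. \<bar>f x\<bar> \<le> poly p x"
  shows "gintegrable f"
  by (rule Bochner_Integration.integrable_bound[OF gintegrable_poly[of p]])
    (use assms in \<open>auto simp: abs_mult intro!: mult_left_mono intro: order_trans[OF _ abs_ge_self]\<close>)

lemma gint_one: "gint (\<lambda>x. 1) = sqrt pi"
proof -
  have "(LBINT x. sqrt pi * normal_density 0 (1 / sqrt 2) x) = sqrt pi"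
    by (simp add: integral_normal_density)
  then show ?thesis by (simp add: gint_def normal_density_def power_divide real_sqrt_divide)
qed

text \<open>The fundamental theorem of calculus for exp(-x^2) u(x), which vanishes at both ends. It
  is kept general in \<open>u\<close> because it serves polynomials as well as sin(bx) and x
  cos(bx).\<close>

lemma gint_by_parts:
  fixes u v :: "real \<Rightarrow> real"
  assumes der: "\<And>x. (u has_real_derivative v x) (at x)"
    and cont: "continuous_on UNIV v"
    and int: "gintegrable v" "gintegrable (\<lambda>x. x * u x)"
    and lim: "((\<lambda>x. exp (- x\<^sup>2) * u x) \<longlongrightarrow> 0) at_top" "((\<lambda>x. exp (- x\<^sup>2) * u x) \<longlongrightarrow> 0) at_bot"
  shows "gint v = 2 * gint (\<lambda>x. x * u x)"
proof -
  have contu: "isCont u x" for x using der by (rule DERIV_isCont)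
  have contv: "isCont v x" for x using cont by (simp add: continuous_on_eq_continuous_at)
  have int': "integrable lborel (\<lambda>x. exp (- x\<^sup>2) * v x - 2 * (exp (- x\<^sup>2) * (x * u x)))"
    using int by auto
  have "(LBINT x=-\<infinity>..\<infinity>. exp (- x\<^sup>2) * v x - 2 * (exp (- x\<^sup>2) * (x * u x))) = 0 - 0"
  proof (rule interval_integral_FTC_integrable)
    show "((\<lambda>x. exp (- x\<^sup>2) * u x) has_vector_derivative
        exp (- x\<^sup>2) * v x - 2 * (exp (- x\<^sup>2) * (x * u x))) (at x)" for x
      unfolding has_real_derivative_iff_has_vector_derivative[symmetric]
      by (auto intro!: derivative_eq_intros der simp: algebra_simps)
    show "isCont (\<lambda>x. exp (- x\<^sup>2) * v x - 2 * (exp (- x\<^sup>2) * (x * u x))) x" for x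
      using contu contv by (intro continuous_intros)
    show "set_integrable lborel (einterval (- \<infinity>) \<infinity>) (\<lambda>x. exp (- x\<^sup>2) * v x - 2 * (exp (- x\<^sup>2) * (x * u x)))"
      using int' by (simp add: set_integrable_def)
    show "(((\<lambda>x. exp (- x\<^sup>2) * u x) \<circ> real_of_ereal) \<longlongrightarrow> 0) (at_right (- \<infinity>))"
      using lim by (simp add: ereal_tendsto_simps)
    show "(((\<lambda>x. exp (- x\<^sup>2) * u x) \<circ> real_of_ereal) \<longlongrightarrow> 0) (at_left \<infinity>)"
      using lim by (simp add: ereal_tendsto_simps)
  qed simp
  then have "(LBINT x. exp (- x\<^sup>2) * v x - 2 * (exp (- x\<^sup>2) * (x * u x))) = 0"
    by (simp add: interval_lebesgue_integral_def set_lebesgue_integral_def)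
  then show ?thesis
    using int unfolding gint_def by (subst (asm) Bochner_Integration.integral_diff) auto
qed

lemma gaussian_poly_tendsto_0:
  fixes p :: "real poly"
  shows "((\<lambda>x. exp (- x\<^sup>2) * poly p x) \<longlongrightarrow> 0) at_top"
    and "((\<lambda>x. exp (- x\<^sup>2) * poly p x) \<longlongrightarrow> 0) at_bot"
proof -
  have lim: "((\<lambda>x::real. exp (- x\<^sup>2) * x ^ i) \<longlongrightarrow> 0) at_top" for i by real_asymp
  have top: "((\<lambda>x. exp (- x\<^sup>2) * poly p x) \<longlongrightarrow> 0) at_top" for p :: "real poly"
  proof -
    have "((\<lambda>x. \<Sum>i\<le>degree p. coeff p i * (exp (- x\<^sup>2) * x ^ i)) \<longlongrightarrow> (\<Sum>i\<le>degree p. coeff p i * 0)) at_top"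
    by (intro tendsto_sum tendsto_mult_left lim)
    then show ?thesis by (simp add: poly_altdef sum_distrib_left mult_ac)
  qed
  from top show "((\<lambda>x. exp (- x\<^sup>2) * poly p x) \<longlongrightarrow> 0) at_top" .
  from top[of "pcompose p [:0, -1:]"] show "((\<lambda>x. exp (- x\<^sup>2) * poly p x) \<longlongrightarrow> 0) at_bot"
    by (simp add: filterlim_at_bot_mirror poly_pcompose)
qed

lemma gaussian_dominated_tendsto_0:
  fixes u :: "real \<Rightarrow> real"
  assumes "\<And>x. \<bar>u x\<bar> \<le> poly p x"
  shows "((\<lambda>x. exp (- x\<^sup>2) * u x) \<longlongrightarrow> 0) at_top" "((\<lambda>x. exp (- x\<^sup>2) * u x) \<longlongrightarrow> 0) at_bot"
proof -
  have "norm (exp (- x\<^sup>2) * u x) \<le> exp (- x\<^sup>2) * poly p x" for x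
    using assms by (simp add: abs_mult)
  then show "((\<lambda>x. exp (- x\<^sup>2) * u x) \<longlongrightarrow> 0) at_top" "((\<lambda>x. exp (- x\<^sup>2) * u x) \<longlongrightarrow> 0) at_bot"
    using Lim_null_comparison gaussian_poly_tendsto_0 by (metis (no_types, lifting) always_eventually)+
qed

lemma gint_pderiv: "gint (poly (pderiv p)) = 2 * gint (\<lambda>x. x * poly p x)"
proof (rule gint_by_parts)
  show "gintegrable (\<lambda>x. x * poly p x)" using gintegrable_poly[of "[:0, 1:] * p"] by simp
qed (auto intro!: gintegrable_poly gaussian_poly_tendsto_0 continuous_intros)

lemma gint_add: "gintegrable f \<Longrightarrow> gintegrable g \<Longrightarrow> gint (\<lambda>x. f x + g x) = gint f + gint g"
  by (simp add: gint_def distrib_left)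

lemma gint_diff: "gintegrable f \<Longrightarrow> gintegrable g \<Longrightarrow> gint (\<lambda>x. f x - g x) = gint f - gint g"
  by (simp add: gint_def right_diff_distrib)

lemma gint_cmult: "gint (\<lambda>x. c * f x) = c * gint f"
  by (simp add: gint_def mult.left_commute)

text \<open>Orthogonality in disguise: by \<open>gint_pderiv\<close>, each application of 2x - d/dx
  in the recurrence moves one derivative onto \<open>p\<close>. For \<open>p\<close> of degree at
  most k, only k! times the coefficient at k survives.\<close>

lemma gint_hermite_mult: "gint (poly (hermite k * p)) = gint (poly ((pderiv ^^ k) p))"
proof (induction k arbitrary: p)
  case (Suc k)
  have "poly (hermite (Suc k) * p) = (\<lambda>x. 2 * (x * poly (hermite k * p) x) - poly (pderiv (hermite k) * p) x)"
    by (auto simp: algebra_simps)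
  moreover have "gintegrable (\<lambda>x. 2 * (x * poly (hermite k * p) x))"
    using gintegrable_poly[of "[:0, 2:] * (hermite k * p)"] by (simp add: mult_ac)
  ultimately have "gint (poly (hermite (Suc k) * p)) =
      gint (poly (pderiv (hermite k * p))) - gint (poly (pderiv (hermite k) * p))"
    by (simp only: gint_diff gintegrable_poly gint_cmult gint_pderiv)
  also have "\<dots> = gint (\<lambda>x. poly (pderiv (hermite k * p)) x - poly (pderiv (hermite k) * p) x)"
    by (simp only: gint_diff gintegrable_poly)
  also have "\<dots> = gint (poly (hermite k * pderiv p))"
    by (simp add: pderiv_mult mult.commute flip: poly_mult)
  also have "\<dots> = gint (poly ((pderiv ^^ k) (pderiv p)))" by (rule Suc)
  finally show ?case by (simp only: funpow_Suc_right comp_def)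
qed simp

lemma gint_poly_const: "gint (poly [:c:]) = c * sqrt pi"
proof -
  have "poly [:c:] = (\<lambda>x. c * 1)" by (rule ext) simp
  then show ?thesis by (simp only: gint_cmult gint_one)
qed

lemma gint_hermite_sq: "gint (\<lambda>x. (poly (hermite k) x)\<^sup>2) = sqrt pi * 2 ^ k * fact k"
proof -
  have "(\<lambda>x. (poly (hermite k) x)\<^sup>2) = poly (hermite k * hermite k)"
    by (rule ext) (simp add: power2_eq_square)
  then show ?thesis
    using higher_pderiv_degree[OF degree_hermite[of k]]
    by (simp only: gint_hermite_mult gint_poly_const coeff_hermite) simp
qed

text \<open>Integration by parts turns the moment of x^2 H^2 into integrals of H^2 and of H times q
  = x H'. Since q has degree at most k, \<open>gint_hermite_mult\<close> sees only its top
  coefficient k 2^k.\<close>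

lemma gint_hermite_sq_moment:
  "gint (\<lambda>x. (1 + x\<^sup>2) * (poly (hermite k) x)\<^sup>2) = (real k + 3 / 2) * (sqrt pi * 2 ^ k * fact k)"
proof -
  let ?h = "hermite k"
  define q where "q = [:0, 1:] * pderiv ?h"
  have q: "degree q \<le> k" "coeff q k = real k * 2 ^ k"
  proof -
    show "degree q \<le> k"
    proof (cases "degree ?h")
      case 0
      then have "pderiv ?h = 0" by (simp add: pderiv_eq_0_iff)
      then show ?thesis by (simp add: q_def)
    next
      case (Suc n)
      then show ?thesis unfolding q_def using degree_hermite[of k]
        by (intro order_trans[OF degree_mult_le]) (simp add: degree_pderiv)
    qed
    show "coeff q k = real k * 2 ^ k"
      by (cases k) (auto simp: q_def coeff_pderiv coeff_hermite simp del: hermite.simps)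
  qed
  have "2 * gint (\<lambda>x. x * poly ([:0, 1:] * ?h * ?h) x) = gint (poly (pderiv ([:0, 1:] * ?h * ?h)))"
    by (simp only: gint_pderiv)
  also have "poly (pderiv ([:0, 1:] * ?h * ?h)) = (\<lambda>x. (poly ?h x)\<^sup>2 + 2 * poly (?h * q) x)"
    by (auto simp: q_def pderiv_mult pderiv_pCons algebra_simps power2_eq_square)
  also have "gint \<dots> = gint (\<lambda>x. (poly ?h x)\<^sup>2) + gint (\<lambda>x. 2 * poly (?h * q) x)"
    using gintegrable_poly[of "?h\<^sup>2"] gintegrable_poly[of "smult 2 (?h * q)"]
    by (intro gint_add) (simp_all add: mult.assoc)
  also have "gint (\<lambda>x. 2 * poly (?h * q) x) = 2 * (sqrt pi * (real k * 2 ^ k * fact k))"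
    unfolding gint_cmult gint_hermite_mult
    using q by (simp add: higher_pderiv_degree gint_poly_const del: poly_pCons)
  finally have "gint (\<lambda>x. x\<^sup>2 * (poly ?h x)\<^sup>2) = (real k + 1 / 2) * (sqrt pi * 2 ^ k * fact k)"
    unfolding gint_hermite_sq by (simp add: field_simps power2_eq_square)
  moreover have "gint (\<lambda>x. (1 + x\<^sup>2) * (poly ?h x)\<^sup>2) =
      gint (\<lambda>x. (poly ?h x)\<^sup>2) + gint (\<lambda>x. x\<^sup>2 * (poly ?h x)\<^sup>2)"
    unfolding distrib_right mult_1 using gintegrable_poly[of "?h\<^sup>2"] gintegrable_poly[of "[:0, 1:]\<^sup>2 * ?h\<^sup>2"]
    by (intro gint_add) simp_all
  ultimately show ?thesis by (simp add: gint_hermite_sq algebra_simps)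
qed

section \<open>Perturbation of inverse quadratic forms\<close>

text \<open>Lax-Milgram in finite dimension: coercivity makes the kernel trivial, hence
  \<open>A\<close> invertible, and Cauchy-Schwarz applied to c |x|^2 <= x . v gives the factor
  1/c.\<close>

lemma coercive_matrix_inv:
  fixes A :: "real ^ 'k ^ 'k"
  assumes "c > 0" and coercive: "\<And>x. c * (norm x)\<^sup>2 \<le> x \<bullet> (A *v x)"
  shows "A *v (matrix_inv A *v v) = v" "matrix_inv A *v (A *v v) = v"
    and "norm (matrix_inv A *v v) \<le> norm v / c"
proof -
  have "x = 0" if "A *v x = 0" for x
    using coercive[of x] that \<open>c > 0\<close> by (simp add: mult_le_0_iff)
  then have "invertible A"
    by (simp add: invertible_left_inverse matrix_left_invertible_ker)
  then have inv: "A ** matrix_inv A = mat 1 \<and> matrix_inv A ** A = mat 1"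
    unfolding invertible_def matrix_inv_def by (rule someI_ex)
  then show *: "A *v (matrix_inv A *v v) = v"
    by (simp add: matrix_vector_mul_assoc)
  show "matrix_inv A *v (A *v v) = v"
    using inv by (simp add: matrix_vector_mul_assoc)
  define x where "x = matrix_inv A *v v"
  have "c * (norm x)\<^sup>2 \<le> x \<bullet> v" using coercive[of x] * by (simp add: x_def)
  also have "\<dots> \<le> norm x * norm v" by (rule norm_cauchy_schwarz)
  finally have "norm x * (c * norm x) \<le> norm x * norm v" by (simp add: power2_eq_square mult_ac)
  then have "c * norm x \<le> norm v" by (cases "norm x = 0") auto
  then show "norm (matrix_inv A *v v) \<le> norm v / c"
    using \<open>c > 0\<close> by (simp add: x_def field_simps)
qed

lemma norm_le_sqrt_CARD:
  fixes v :: "real ^ 'k"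
  assumes "\<And>i. \<bar>v $ i\<bar> \<le> b"
  shows "norm v \<le> sqrt (real CARD('k)) * b"
proof -
  have "b \<ge> 0" using assms[of undefined] by linarith
  have "(\<Sum>i\<in>UNIV. (v $ i)\<^sup>2) \<le> (\<Sum>i\<in>(UNIV :: 'k set). b\<^sup>2)"
    by (intro sum_mono) (simp add: abs_le_square_iff[symmetric] assms \<open>b \<ge> 0\<close>)
  then have "sqrt (\<Sum>i\<in>UNIV. (v $ i)\<^sup>2) \<le> sqrt (real CARD('k) * b\<^sup>2)" by simp
  then show ?thesis using \<open>b \<ge> 0\<close> by (simp add: norm_vec_def L2_set_def real_sqrt_mult)
qed

lemma norm_matrix_vector_le:
  fixes A :: "real ^ 'k ^ 'k"
  assumes "\<And>i j. \<bar>A $ i $ j\<bar> \<le> b"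
  shows "norm (A *v x) \<le> real CARD('k) * b * norm x"
proof -
  have "\<bar>(A *v x) $ i\<bar> \<le> sqrt (real CARD('k)) * b * norm x" for i
  proof -
    have "\<bar>A $ i \<bullet> x\<bar> \<le> norm (A $ i) * norm x" by (rule Cauchy_Schwarz_ineq2)
    also have "\<dots> \<le> sqrt (real CARD('k)) * b * norm x"
      by (intro mult_right_mono norm_le_sqrt_CARD assms) simp
    finally show ?thesis by (simp add: matrix_vector_mul_component)
  qed
  then have "norm (A *v x) \<le> sqrt (real CARD('k)) * (sqrt (real CARD('k)) * b * norm x)"
    by (rule norm_le_sqrt_CARD)
  then show ?thesis by (simp add: mult.assoc[symmetric])
qed

text \<open>The difference is telescoped over the left vector, the inverse and the right vector.
  Separate errors \<open>e\<close> and \<open>e'\<close> serve both uses: posterior means have the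
  exact data on the right (\<open>e'\<close> = 0), variances the perturbed vector on both sides. The
  powers of the dimension come from passing between entrywise bounds and Euclidean norms.\<close>

lemma inverse_form_perturbation:
  fixes A B :: "real ^ 'k ^ 'k" and v w z z' :: "real ^ 'k"
  assumes c: "c > 0"
    and A: "\<And>x. c * (norm x)\<^sup>2 \<le> x \<bullet> (A *v x)"
    and B: "\<And>x. c * (norm x)\<^sup>2 \<le> x \<bullet> (B *v x)"
    and AB: "\<And>i j. \<bar>A $ i $ j - B $ i $ j\<bar> \<le> e"
    and vw: "\<And>i. \<bar>v $ i - w $ i\<bar> \<le> e"
    and zz: "\<And>i. \<bar>z $ i - z' $ i\<bar> \<le> e'"
    and w: "\<And>i. \<bar>w $ i\<bar> \<le> p"
    and z: "\<And>i. \<bar>z $ i\<bar> \<le> r"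
  shows "\<bar>v \<bullet> (matrix_inv A *v z) - w \<bullet> (matrix_inv B *v z')\<bar>
    \<le> real CARD('k) * (e * r / c + p * e' / c) + (real CARD('k))\<^sup>2 * p * e * r / c\<^sup>2"
proof -
  let ?N = "real CARD('k)"
  note iA = coercive_matrix_inv[OF c A]
  note iB = coercive_matrix_inv[OF c B]
  have e0: "e \<ge> 0" and p0: "p \<ge> 0" and r0: "r \<ge> 0"
    using vw[of undefined] w[of undefined] z[of undefined] by linarith+
  have nvw: "norm (v - w) \<le> sqrt ?N * e" by (intro norm_le_sqrt_CARD) (simp add: vw)
  have nzz: "norm (z - z') \<le> sqrt ?N * e'" by (intro norm_le_sqrt_CARD) (simp add: zz)
  have nw: "norm w \<le> sqrt ?N * p" by (intro norm_le_sqrt_CARD w)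
  have nz: "norm z \<le> sqrt ?N * r" by (intro norm_le_sqrt_CARD z)
  define x where "x = matrix_inv A *v z"
  have nx: "norm x \<le> sqrt ?N * r / c"
    using divide_right_mono[OF nz, of c] iA(3)[of z] c by (simp add: x_def)
  define y where "y = matrix_inv B *v ((B - A) *v x)"
  have "norm ((B - A) *v x) \<le> ?N * e * norm x"
    by (intro norm_matrix_vector_le) (use AB in \<open>simp add: abs_minus_commute\<close>)
  also have "\<dots> \<le> ?N * e * (sqrt ?N * r / c)" by (intro mult_left_mono nx) (use e0 in auto)
  finally have "norm ((B - A) *v x) / c \<le> ?N * e * (sqrt ?N * r / c) / c"
    using c by (intro divide_right_mono) auto
  then have ny: "norm y \<le> ?N * e * (sqrt ?N * r / c) / c"
    using iB(3)[of "(B - A) *v x"] unfolding y_def by linarith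
  \<comment> \<open>The resolvent identity B^-1 (B - A) A^-1 = A^-1 - B^-1, applied to
    \<open>z\<close>.\<close>
  have "y = x - matrix_inv B *v z"
    by (simp add: y_def x_def matrix_vector_mult_diff_rdistrib matrix_vector_mult_diff_distrib iA(1) iB(2))
  then have "v \<bullet> (matrix_inv A *v z) - w \<bullet> (matrix_inv B *v z')
      = (v - w) \<bullet> x + w \<bullet> y + w \<bullet> (matrix_inv B *v (z - z'))"
    by (simp add: x_def[symmetric] matrix_vector_mult_diff_distrib inner_diff_left inner_diff_right)
  also have "\<bar>\<dots>\<bar> \<le> norm (v - w) * norm x + norm w * norm y + norm w * norm (matrix_inv B *v (z - z'))"
    using Cauchy_Schwarz_ineq2[of "v - w" x] Cauchy_Schwarz_ineq2[of w y]
      Cauchy_Schwarz_ineq2[of w "matrix_inv B *v (z - z')"] by linarith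
  also have "\<dots> \<le> (sqrt ?N * e) * (sqrt ?N * r / c) + (sqrt ?N * p) * (?N * e * (sqrt ?N * r / c) / c)
      + (sqrt ?N * p) * (sqrt ?N * e' / c)"
  proof (intro add_mono mult_mono nvw nx nw ny)
    show "norm (matrix_inv B *v (z - z')) \<le> sqrt ?N * e' / c"
      using iB(3)[of "z - z'"] nzz c by (smt (verit) divide_right_mono)
  qed (use e0 p0 r0 c in auto)
  also have "\<dots> = ?N * (e * r / c + p * e' / c) + ?N\<^sup>2 * p * e * r / c\<^sup>2"
  proof -
    have s: "sqrt ?N * sqrt ?N = ?N" by simp
    have "(sqrt ?N * e) * (sqrt ?N * r / c) = ?N * (e * r / c)"
      using s by (metis (no_types, opaque_lifting) mult.assoc mult.left_commute times_divide_eq_right)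
    moreover have "(sqrt ?N * p) * (sqrt ?N * e' / c) = ?N * (p * e' / c)"
      using s by (metis (no_types, opaque_lifting) mult.assoc mult.left_commute times_divide_eq_right)
    moreover have "(sqrt ?N * p) * (?N * e * (sqrt ?N * r / c) / c) = (sqrt ?N * sqrt ?N) * ?N * p * e * r / c\<^sup>2"
      by (simp add: power2_eq_square)
    ultimately show ?thesis unfolding s by (simp add: power2_eq_square algebra_simps)
  qed
  finally show ?thesis .
qed

section \<open>Coercivity of the regularised covariance matrix\<close>

lemma sum_UNIV_Plus:
  fixes f :: "'a::finite + 'b::finite \<Rightarrow> 'c::comm_monoid_add"
  shows "(\<Sum>r\<in>UNIV. f r) = (\<Sum>i\<in>UNIV. f (Inl i)) + (\<Sum>i\<in>UNIV. f (Inr i))"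
  by (simp add: UNIV_Plus_UNIV[symmetric] sum.Plus del: UNIV_Plus_UNIV)

text \<open>The quadratic form of the noise-free part of \<open>K_hat\<close> at the block vector
  (u, v). It is spelled out in entries so that, for a kernel given by an integral, the sums can be
  moved under the integral sign.\<close>

definition psd_jet :: "jet \<Rightarrow> real ^ 'n \<Rightarrow> bool" where
  "psd_jet J t \<longleftrightarrow> (\<forall>u v :: real ^ 'n. 0 \<le> (\<Sum>i\<in>UNIV. \<Sum>j\<in>UNIV.
     u $ i * u $ j * val J (t $ i) (t $ j) + u $ i * v $ j * d2 J (t $ i) (t $ j)
     + v $ i * u $ j * d1 J (t $ i) (t $ j) + v $ i * v $ j * d12 J (t $ i) (t $ j)))"

lemma K_hat_coercive:
  fixes t :: "real ^ 'n"
  assumes "psd_jet J t" "c \<le> s" "c \<le> \<gamma>"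
  shows "c * (norm x)\<^sup>2 \<le> x \<bullet> (K_hat J t s \<gamma> *v x)"
proof -
  define u v :: "real ^ 'n" where "u = (\<chi> i. x $ Inl i)" and "v = (\<chi> i. x $ Inr i)"
  define Q where "Q = (\<Sum>i\<in>UNIV. \<Sum>j\<in>UNIV.
     u $ i * u $ j * val J (t $ i) (t $ j) + u $ i * v $ j * d2 J (t $ i) (t $ j)
     + v $ i * u $ j * d1 J (t $ i) (t $ j) + v $ i * v $ j * d12 J (t $ i) (t $ j))"
  have "Q \<ge> 0" using assms(1) unfolding psd_jet_def Q_def by blast
  have x: "x $ Inl i = u $ i" "x $ Inr i = v $ i" for i by (simp_all add: u_def v_def)
  have d: "(\<Sum>j\<in>UNIV. w $ i * (w $ j * (mat a :: real ^ 'n ^ 'n) $ i $ j)) = a * (w $ i * w $ i)"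
    for a i and w :: "real ^ 'n"
    by (simp add: mat_def if_distrib cong: if_cong)
  have "x \<bullet> (K_hat J t s \<gamma> *v x) = Q + s * (\<Sum>i\<in>UNIV. (u $ i)\<^sup>2) + \<gamma> * (\<Sum>i\<in>UNIV. (v $ i)\<^sup>2)"
    by (simp add: inner_vec_def sum_UNIV_Plus K_hat_def block_mat_def matrix_vector_mult_def gram_def x
        distrib_right d Q_def sum.distrib sum_distrib_left algebra_simps power2_eq_square)
  moreover have "(norm x)\<^sup>2 = (\<Sum>i\<in>UNIV. (u $ i)\<^sup>2) + (\<Sum>i\<in>UNIV. (v $ i)\<^sup>2)"
    unfolding power2_norm_eq_inner by (simp add: inner_vec_def sum_UNIV_Plus x power2_eq_square)
  moreover have "c * (\<Sum>i\<in>UNIV. (u $ i)\<^sup>2) \<le> s * (\<Sum>i\<in>UNIV. (u $ i)\<^sup>2)"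
    "c * (\<Sum>i\<in>UNIV. (v $ i)\<^sup>2) \<le> \<gamma> * (\<Sum>i\<in>UNIV. (v $ i)\<^sup>2)"
    using assms by (auto intro!: mult_right_mono sum_nonneg)
  ultimately show ?thesis using \<open>Q \<ge> 0\<close> by (simp add: distrib_left)
qed

section \<open>Quadrature of trigonometric functions\<close>

text \<open>The characteristic function of the standard normal distribution at b / sqrt 2, after
  rescaling the variable by sqrt 2.\<close>

lemma gint_cos: "gint (\<lambda>x. cos (b * x)) = sqrt pi * exp (- b\<^sup>2 / 4)"
proof -
  define t where "t = b / sqrt 2"
  interpret std: real_distribution std_normal_distribution
    by (rule real_dist_normal_dist)
  have int: "complex_integrable std_normal_distribution (\<lambda>x. iexp (t * x))"
    by (rule std.integrable_iexp) auto
  have "(LINT x|std_normal_distribution. cos (t * x)) = Re (char std_normal_distribution t)"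
    unfolding char_def using integral_Re[OF int, symmetric] by (simp add: Re_exp)
  also have "\<dots> = exp (- t\<^sup>2 / 2)" by (simp only: char_std_normal_distribution Re_complex_of_real)
  finally have "(LINT x|std_normal_distribution. cos (t * x)) = exp (- t\<^sup>2 / 2)" .
  moreover have "(LINT x|std_normal_distribution. cos (t * x)) = (LBINT x. std_normal_density x * cos (t * x))"
    by (subst integral_density) auto
  moreover have "(LBINT x. std_normal_density x * cos (t * x))
      = sqrt 2 * (LBINT x. std_normal_density (sqrt 2 * x) * cos (t * (sqrt 2 * x)))"
    using lborel_integral_real_affine[of "sqrt 2" "\<lambda>x. std_normal_density x * cos (t * x)" 0] by simp
  moreover have "sqrt 2 * (LBINT x. std_normal_density (sqrt 2 * x) * cos (t * (sqrt 2 * x)))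
      = (LBINT x. (1 / sqrt pi) * (exp (- x\<^sup>2) * cos (b * x)))"
    unfolding integral_mult_right_zero[symmetric]
    by (rule arg_cong[of _ _ "integral\<^sup>L lborel"])
      (auto simp: std_normal_density_def t_def real_sqrt_mult power_mult_distrib)
  moreover have "t\<^sup>2 / 2 = b\<^sup>2 / 4" by (simp add: t_def power_divide)
  ultimately show ?thesis by (simp add: gint_def field_simps)
qed

lemma abs_mult_cos_le: "\<bar>x\<bar> * \<bar>cos y\<bar> \<le> \<bar>x::real\<bar>" and abs_mult_sin_le: "\<bar>x\<bar> * \<bar>sin y\<bar> \<le> \<bar>x::real\<bar>"
  by (auto simp: mult_left_le)

lemma abs_le_one_plus_sq: "\<bar>x::real\<bar> \<le> 1 + x\<^sup>2"
proof -
  have "0 \<le> (\<bar>x\<bar> - 1)\<^sup>2" by simp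
  then have "2 * \<bar>x\<bar> \<le> 1 + x\<^sup>2" by (simp add: power2_diff)
  then show ?thesis using abs_ge_zero[of x] by linarith
qed

lemma gintegrable_trig:
  assumes "f \<in> borel_measurable borel" "\<And>x. \<bar>f x\<bar> \<le> 1"
  shows "gintegrable f" "gintegrable (\<lambda>x. x * f x)" "gintegrable (\<lambda>x. x\<^sup>2 * f x)"
proof -
  note [measurable] = assms(1)
  have p: "poly [:1, 0, 1:] x = 1 + x\<^sup>2" for x :: real by (simp add: power2_eq_square)
  have f: "\<bar>z * f x\<bar> \<le> \<bar>z\<bar>" for z x
    using assms(2)[of x] by (simp add: abs_mult mult_left_le)
  show "gintegrable f"
    by (rule gintegrable_dominated[of _ "[:1, 0, 1:]"]) (unfold p, use f[of 1] in \<open>auto intro: order_trans[OF assms(2)]\<close>)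
  show "gintegrable (\<lambda>x. x * f x)"
    by (rule gintegrable_dominated[of _ "[:1, 0, 1:]"]) (unfold p, use f in \<open>auto intro: order_trans[OF f abs_le_one_plus_sq]\<close>)
  show "gintegrable (\<lambda>x. x\<^sup>2 * f x)"
    by (rule gintegrable_dominated[of _ "[:1, 0, 1:]"]) (unfold p, auto intro: order_trans[OF f])
qed

lemma gint_mult_sin: "gint (\<lambda>x. x * sin (b * x)) = b / 2 * gint (\<lambda>x. cos (b * x))"
proof -
  have bd: "\<bar>sin (b * x)\<bar> \<le> poly 1 x" for x by simp
  have "gint (\<lambda>x. b * cos (b * x)) = 2 * gint (\<lambda>x. x * sin (b * x))"
  proof (rule gint_by_parts)
    show "gintegrable (\<lambda>x. x * sin (b * x))" by (rule gintegrable_trig) auto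
    show "gintegrable (\<lambda>x. b * cos (b * x))"
      using integrable_mult_right[OF gintegrable_trig(1)[of "\<lambda>x. cos (b * x)"], of b]
      by (simp add: mult.left_commute)
    show "((\<lambda>x. exp (- x\<^sup>2) * sin (b * x)) \<longlongrightarrow> 0) at_top" "((\<lambda>x. exp (- x\<^sup>2) * sin (b * x)) \<longlongrightarrow> 0) at_bot"
      using gaussian_dominated_tendsto_0[of "\<lambda>x. sin (b * x)", OF bd] by blast+
  qed (auto intro!: derivative_eq_intros continuous_intros)
  then show ?thesis by (simp add: gint_cmult)
qed

text \<open>Integration by parts with u = x cos(bx), the remaining sine integral being
  \<open>gint_mult_sin\<close>. The case b = 0 later yields the second moment.\<close>

lemma gint_sq_mult_cos: "gint (\<lambda>x. x\<^sup>2 * cos (b * x)) = (1 / 2 - b\<^sup>2 / 4) * gint (\<lambda>x. cos (b * x))"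
proof -
  have bd: "\<bar>x * cos (b * x)\<bar> \<le> poly [:1, 0, 1:] x" for x
    using abs_le_one_plus_sq[of x] abs_mult_cos_le[of x "b * x"]
    by (simp add: abs_mult power2_eq_square)
  have i1: "gintegrable (\<lambda>x. cos (b * x))" by (rule gintegrable_trig) auto
  have i2: "gintegrable (\<lambda>x. b * (x * sin (b * x)))"
    using integrable_mult_right[OF gintegrable_trig(2)[of "\<lambda>x. sin (b * x)"], of b]
    by (simp add: mult_ac)
  have "gint (\<lambda>x. cos (b * x) - b * (x * sin (b * x))) = 2 * gint (\<lambda>x. x * (x * cos (b * x)))"
  proof (rule gint_by_parts)
    show "gintegrable (\<lambda>x. x * (x * cos (b * x)))"
      using gintegrable_trig(3)[of "\<lambda>x. cos (b * x)"] by (simp add: power2_eq_square mult.assoc)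
    show "gintegrable (\<lambda>x. cos (b * x) - b * (x * sin (b * x)))"
      using i1 i2 by (simp add: right_diff_distrib)
    show "((\<lambda>x. exp (- x\<^sup>2) * (x * cos (b * x))) \<longlongrightarrow> 0) at_top"
      "((\<lambda>x. exp (- x\<^sup>2) * (x * cos (b * x))) \<longlongrightarrow> 0) at_bot"
      using gaussian_dominated_tendsto_0[of "\<lambda>x. x * cos (b * x)", OF bd] by blast+
  qed (auto intro!: derivative_eq_intros continuous_intros)
  also have "gint (\<lambda>x. cos (b * x) - b * (x * sin (b * x)))
      = gint (\<lambda>x. cos (b * x)) - b * (b / 2 * gint (\<lambda>x. cos (b * x)))"
    using i1 i2 by (simp only: gint_diff gint_cmult gint_mult_sin)
  finally show ?thesis by (simp add: power2_eq_square mult.assoc algebra_simps)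
qed

lemma gint_sq: "gint (\<lambda>x. x\<^sup>2) = sqrt pi / 2"
  using gint_sq_mult_cos[of 0] by (simp add: gint_one)

text \<open>One polynomial \<open>r\<close> dominates the remainder pointwise, and this passes to
  the integral and, the weights being positive, to the rule. Both agree on \<open>r\<close> and on
  the interpolant times \<open>\<psi>\<close>, so the total error is at most twice the integral of
  \<open>r\<close>; hence 2k + 3 instead of k + 3/2.\<close>

lemma gauss_hermite_error:
  fixes F :: "nat \<Rightarrow> real \<Rightarrow> real"
  assumes gh: "gauss_hermite (k + 2) \<omega> W"
    and der: "\<And>j x. (F j has_real_derivative F (Suc j) x) (at x)"
    and B: "\<And>x. \<bar>F (2 * k) x\<bar> \<le> B"
    and \<psi>: "degree \<psi> \<le> 2" "\<And>x. \<bar>poly \<psi> x\<bar> \<le> 1 + x\<^sup>2"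
    and int: "gintegrable (\<lambda>x. poly \<psi> x * F 0 x)"
  shows "\<bar>gint (\<lambda>x. poly \<psi> x * F 0 x) - (\<Sum>q<k + 2. W q * (poly \<psi> (\<omega> q) * F 0 (\<omega> q)))\<bar>
    \<le> sqrt pi * ((2 * real k + 3) * B * fact k / (fact (2 * k) * 2 ^ k))"
proof -
  let ?Q = "\<lambda>f. \<Sum>q<k + 2. W q * f (\<omega> q)"
  have W: "W q > 0" if "q < k + 2" for q using gh that by (simp add: gauss_hermite_def)
  have exact: "gint (poly p) = ?Q (poly p)" if "degree p < 2 * (k + 2)" for p
    using gh that unfolding gauss_hermite_def gint_def by (blast intro: has_bochner_integral_integral_eq)
  let ?Z = "{x. poly (hermite (k + 2)) x = 0}"
  have "bij_betw \<omega> {..<k + 2} ?Z" using gh by (simp add: gauss_hermite_def)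
  then have "finite ?Z" "card ?Z = k + 2"
    using bij_betw_finite bij_betw_same_card by fastforce+
  then obtain S where S: "finite S" "card S = k" "\<forall>x\<in>S. poly (hermite k) x = 0"
    using hermite_real_rooted_descent[of k 2] by blast
  define h where "h = node_poly S"
  have Hh: "hermite k = smult (2 ^ k) h"
    unfolding h_def using S by (intro hermite_eq_node_poly) auto
  define D where "D = B / fact (2 * k)"
  have "B \<ge> 0" using B[of 0] by linarith
  then have D0: "D \<ge> 0" by (simp add: D_def)
  obtain p where p: "p = 0 \<or> degree p < 2 * k"
    and err: "\<And>x. \<bar>F 0 x - poly p x\<bar> \<le> D * (poly h x)\<^sup>2"
    using hermite_interpolation_error[of F, OF der S(1), of B] B S(2) unfolding h_def D_def by auto
  define r where "r = smult D ([:1, 0, 1:] * h\<^sup>2)"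
  have r: "poly r x = D * ((1 + x\<^sup>2) * (poly h x)\<^sup>2)" for x
    by (simp add: r_def power2_eq_square algebra_simps)
  have bound: "\<bar>poly \<psi> x * F 0 x - poly (\<psi> * p) x\<bar> \<le> poly r x" for x
  proof -
    have "\<bar>poly \<psi> x * F 0 x - poly (\<psi> * p) x\<bar> = \<bar>poly \<psi> x\<bar> * \<bar>F 0 x - poly p x\<bar>"
      by (simp add: abs_mult[symmetric] right_diff_distrib)
    also have "\<dots> \<le> (1 + x\<^sup>2) * (D * (poly h x)\<^sup>2)"
      by (intro mult_mono \<psi> err) auto
    finally show ?thesis by (simp add: r mult_ac)
  qed
  have dr: "degree r < 2 * (k + 2)"
  proof -
    have "degree r \<le> degree ([:1, 0, 1:] * h\<^sup>2)" by (simp add: r_def)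
    also have "\<dots> \<le> 2 + 2 * degree h"
      by (rule order_trans[OF degree_mult_le]) (use degree_power_le[of h 2] in auto)
    finally show ?thesis using S(2) by (simp add: h_def degree_node_poly)
  qed
  have dp: "degree (\<psi> * p) < 2 * (k + 2)"
    using p degree_mult_le[of \<psi> p] \<psi>(1) by auto
  have I: "\<bar>gint (\<lambda>x. poly \<psi> x * F 0 x) - gint (poly (\<psi> * p))\<bar> \<le> gint (poly r)"
  proof -
    have "\<bar>gint (\<lambda>x. poly \<psi> x * F 0 x - poly (\<psi> * p) x)\<bar> \<le> gint (poly r)"
      unfolding gint_def real_norm_def[symmetric]
    proof (rule Bochner_Integration.integral_norm_bound_integral)
      show "gintegrable (\<lambda>x. poly \<psi> x * F 0 x - poly (\<psi> * p) x)"
        using int gintegrable_poly[of "\<psi> * p"] unfolding right_diff_distrib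
        by (rule Bochner_Integration.integrable_diff)
    qed (use bound in \<open>auto intro!: gintegrable_poly simp: abs_mult\<close>)
    then show ?thesis by (simp only: gint_diff[OF int gintegrable_poly])
  qed
  have Q: "\<bar>?Q (\<lambda>x. poly \<psi> x * F 0 x) - ?Q (poly (\<psi> * p))\<bar> \<le> ?Q (poly r)"
  proof -
    have "\<bar>\<Sum>q<k + 2. W q * (poly \<psi> (\<omega> q) * F 0 (\<omega> q) - poly (\<psi> * p) (\<omega> q))\<bar> \<le> ?Q (poly r)"
      by (rule order_trans[OF sum_abs], rule sum_mono)
        (use bound W in \<open>auto simp: abs_mult less_imp_le intro!: mult_left_mono\<close>)
    then show ?thesis by (simp only: right_diff_distrib sum_subtractf)
  qed
  \<comment> \<open>The node polynomial is H_k / 2^k, so its square carries 4^-k; the norm of H_k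
    gives back 2^k.\<close>
  have "gint (poly r) = D * (gint (\<lambda>x. (1 + x\<^sup>2) * (poly (hermite k) x)\<^sup>2) / 4 ^ k)"
  proof -
    have "gint (\<lambda>x. (1 + x\<^sup>2) * (poly (hermite k) x)\<^sup>2) = gint (\<lambda>x. 4 ^ k * ((1 + x\<^sup>2) * (poly h x)\<^sup>2))"
      unfolding Hh by (simp add: power_mult_distrib mult_ac power_mult[symmetric] power2_eq_square flip: power_mult_distrib)
    moreover have "poly r = (\<lambda>x. D * ((1 + x\<^sup>2) * (poly h x)\<^sup>2))" using r by blast
    ultimately show ?thesis by (simp only: gint_cmult) simp
  qed
  also have "\<dots> = D * ((real k + 3 / 2) * (sqrt pi * fact k) / 2 ^ k)"
    unfolding gint_hermite_sq_moment by (simp add: field_simps power_mult_distrib[symmetric])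
  finally have "2 * gint (poly r) = sqrt pi * ((2 * real k + 3) * B * fact k / (fact (2 * k) * 2 ^ k))"
    by (simp add: D_def field_simps)
  then show ?thesis using I Q exact[OF dr] exact[OF dp] by linarith
qed

text \<open>The phase \<open>\<theta>\<close> makes cosine and sine one case, and differentiation
  becomes a shift of the phase by pi/2. The bound on b^2 is written as 2L because its power 2^k
  cancels the 2^k left by the monic normalisation.\<close>

lemma gauss_hermite_trig_error:
  assumes gh: "gauss_hermite (k + 2) \<omega> W"
    and \<psi>: "degree \<psi> \<le> 2" "\<And>x. \<bar>poly \<psi> x\<bar> \<le> 1 + x\<^sup>2"
    and b: "b\<^sup>2 \<le> 2 * L"
  shows "\<bar>gint (\<lambda>x. poly \<psi> x * cos (b * x + \<theta>)) - (\<Sum>q<k + 2. W q * (poly \<psi> (\<omega> q) * cos (b * \<omega> q + \<theta>)))\<bar>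
    \<le> sqrt pi * ((2 * real k + 3) * L ^ k * fact k / fact (2 * k))"
proof -
  define F where "F = (\<lambda>(j::nat) x. b ^ j * cos (b * x + \<theta> + real j * (pi / 2)))"
  have "(F j has_real_derivative F (Suc j) x) (at x)" for j x
  proof -
    have "cos (b * x + \<theta> + real (Suc j) * (pi / 2)) = - sin (b * x + \<theta> + real j * (pi / 2))"
    proof -
      have "b * x + \<theta> + real (Suc j) * (pi / 2) = b * x + \<theta> + real j * (pi / 2) + pi / 2"
        by (simp add: algebra_simps add_divide_distrib)
      then show ?thesis by (simp only: cos_add cos_pi_half sin_pi_half mult_zero_right mult_1_right diff_0)
    qed
    then show ?thesis unfolding F_def by (auto intro!: derivative_eq_intros)
  qed
  moreover have "\<bar>F (2 * k) x\<bar> \<le> (2 * L) ^ k" for x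
  proof -
    have "\<bar>F (2 * k) x\<bar> \<le> \<bar>b ^ (2 * k)\<bar>" unfolding F_def abs_mult by (rule abs_mult_cos_le)
    also have "\<dots> = (b\<^sup>2) ^ k" by (simp add: power_mult)
    also have "\<dots> \<le> (2 * L) ^ k" using b by (intro power_mono) auto
    finally show ?thesis .
  qed
  moreover have "gintegrable (\<lambda>x. poly \<psi> x * F 0 x)"
  proof (rule gintegrable_dominated[of _ "[:1, 0, 1:]"])
    show "\<bar>poly \<psi> x * F 0 x\<bar> \<le> poly [:1, 0, 1:] x" for x
      using abs_mult_cos_le[of "poly \<psi> x" "b * x + \<theta>"] \<psi>(2)[of x]
      by (simp add: F_def abs_mult power2_eq_square)
    show "(\<lambda>x. poly \<psi> x * F 0 x) \<in> borel_measurable borel"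
      unfolding F_def by (intro borel_measurable_continuous_onI continuous_intros)
  qed
  ultimately have "\<bar>gint (\<lambda>x. poly \<psi> x * F 0 x) - (\<Sum>q<k + 2. W q * (poly \<psi> (\<omega> q) * F 0 (\<omega> q)))\<bar>
    \<le> sqrt pi * ((2 * real k + 3) * (2 * L) ^ k * fact k / (fact (2 * k) * 2 ^ k))"
    using gauss_hermite_error[OF gh _ _ \<psi>, of F] by blast
  also have "(2 * real k + 3) * (2 * L) ^ k * fact k / (fact (2 * k) * 2 ^ k)
      = (2 * real k + 3) * L ^ k * fact k / fact (2 * k)"
    by (simp add: power_mult_distrib)
  finally show ?thesis by (simp add: F_def)
qed

section \<open>Kernels as integrals over frequencies\<close>

text \<open>The last three fields are the formal derivatives of cos(a (x - y) w) under the integral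
  sign. Whether they are the derivatives of the kernel is settled separately for each of the two
  measures.\<close>

definition spectral_jet :: "real measure \<Rightarrow> real \<Rightarrow> jet" where
  "spectral_jet M a =
    \<lparr> val = (\<lambda>x y. \<integral>w. cos (a * (x - y) * w) \<partial>M),
      d1 = (\<lambda>x y. \<integral>w. - (a * (w * sin (a * (x - y) * w))) \<partial>M),
      d2 = (\<lambda>x y. \<integral>w. a * (w * sin (a * (x - y) * w)) \<partial>M),
      d12 = (\<lambda>x y. \<integral>w. a\<^sup>2 * (w\<^sup>2 * cos (a * (x - y) * w)) \<partial>M) \<rparr>"

text \<open>The Gaussian measure and the quadrature measure share these two moments, because the
  rule is exact in degrees 0 and 2. Every bound derived from them therefore holds for both kernels
  with the same constant.\<close>

locale spectral_measure =
  fixes M :: "real measure" and \<rho> :: real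
  assumes sets: "sets M = sets borel"
    and integrable_one: "integrable M (\<lambda>w. 1 :: real)"
    and integrable_sq: "integrable M (\<lambda>w. w\<^sup>2)"
    and mass: "(\<integral>w. 1 \<partial>M) = \<rho>"
    and second_moment: "(\<integral>w. w\<^sup>2 \<partial>M) = \<rho> / 2"
begin

lemma integrable_dominated:
  fixes f :: "real \<Rightarrow> real"
  assumes "f \<in> borel_measurable borel" "\<And>w. \<bar>f w\<bar> \<le> B * 1 + D * w\<^sup>2"
  shows "integrable M f" "\<bar>\<integral>w. f w \<partial>M\<bar> \<le> \<rho> * (B + D / 2)"
proof -
  have int: "integrable M (\<lambda>w. B * 1 + D * w\<^sup>2)"
    using integrable_one integrable_sq by (intro Bochner_Integration.integrable_add integrable_mult_right)
  have meas: "f \<in> borel_measurable M" using assms(1) sets by (simp cong: measurable_cong_sets)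
  show "integrable M f"
    by (rule Bochner_Integration.integrable_bound[OF int meas])
      (use assms(2) in \<open>auto intro: order_trans[OF _ abs_ge_self]\<close>)
  then have "\<bar>\<integral>w. f w \<partial>M\<bar> \<le> (\<integral>w. B * 1 + D * w\<^sup>2 \<partial>M)"
    unfolding real_norm_def[symmetric]
    by (rule Bochner_Integration.integral_norm_bound_integral[OF _ int]) (use assms(2) in auto)
  also have "\<dots> = B * (\<integral>w. 1 \<partial>M) + D * (\<integral>w. w\<^sup>2 \<partial>M)"
    using integrable_one integrable_sq
    by (subst Bochner_Integration.integral_add) (auto simp only: integrable_mult_right integral_mult_right_zero)
  also have "\<dots> = \<rho> * (B + D / 2)"
    unfolding mass second_moment by (simp add: algebra_simps)
  finally show "\<bar>\<integral>w. f w \<partial>M\<bar> \<le> \<rho> * (B + D / 2)" .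
qed

text \<open>The trivial factors and summands give each bound the shape that
  \<open>integrable_dominated\<close> matches. The sine bound is |aw| <= (1 + (aw)^2) / 2, which
  avoids a first absolute moment.\<close>

lemma trig_dominated:
  fixes a b w :: real
  shows
  "\<bar>cos (b * w)\<bar> \<le> 1 * 1 + 0 * w\<^sup>2"
  "\<bar>a * (w * sin (b * w))\<bar> \<le> 1 / 2 * 1 + a\<^sup>2 / 2 * w\<^sup>2"
  "\<bar>a\<^sup>2 * (w\<^sup>2 * cos (b * w))\<bar> \<le> 0 * 1 + a\<^sup>2 * w\<^sup>2"
proof -
  have "0 \<le> (\<bar>a * w\<bar> - 1)\<^sup>2" by simp
  then have "2 * \<bar>a * w\<bar> \<le> 1 + a\<^sup>2 * w\<^sup>2" by (simp add: power2_diff power_mult_distrib)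
  then show "\<bar>a * (w * sin (b * w))\<bar> \<le> 1 / 2 * 1 + a\<^sup>2 / 2 * w\<^sup>2"
    using abs_mult_sin_le[of "a * w" "b * w"] by (simp add: abs_mult mult.assoc)
  show "\<bar>a\<^sup>2 * (w\<^sup>2 * cos (b * w))\<bar> \<le> 0 * 1 + a\<^sup>2 * w\<^sup>2"
    using abs_mult_cos_le[of "a\<^sup>2 * w\<^sup>2" "b * w"] by (simp add: abs_mult mult.assoc)
qed simp

lemma integrable_trig:
  "integrable M (\<lambda>w. cos (b * w))"
  "integrable M (\<lambda>w. a * (w * sin (b * w)))"
  "integrable M (\<lambda>w. a\<^sup>2 * (w\<^sup>2 * cos (b * w)))"
  by (rule integrable_dominated(1)[OF _ trig_dominated(1)] integrable_dominated(1)[OF _ trig_dominated(2)]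
      integrable_dominated(1)[OF _ trig_dominated(3)]; simp)+

lemma spectral_jet_bound:
  assumes "\<rho> > 0" "a\<^sup>2 \<le> 2 * L" "1 \<le> L"
  shows "\<bar>val (spectral_jet M a) x y\<bar> \<le> \<rho> * L" "\<bar>d1 (spectral_jet M a) x y\<bar> \<le> \<rho> * L"
    "\<bar>d2 (spectral_jet M a) x y\<bar> \<le> \<rho> * L" "\<bar>d12 (spectral_jet M a) x y\<bar> \<le> \<rho> * L"
proof -
  let ?b = "a * (x - y)"
  have "\<bar>\<integral>w. cos (?b * w) \<partial>M\<bar> \<le> \<rho> * (1 + 0 / 2)"
    by (rule integrable_dominated(2)[OF _ trig_dominated(1)]) simp
  also have "\<dots> \<le> \<rho> * L" using assms by simp
  finally show "\<bar>val (spectral_jet M a) x y\<bar> \<le> \<rho> * L" by (simp add: spectral_jet_def)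
  have "\<bar>\<integral>w. a * (w * sin (?b * w)) \<partial>M\<bar> \<le> \<rho> * (1 / 2 + a\<^sup>2 / 2 / 2)"
    by (rule integrable_dominated(2)[OF _ trig_dominated(2)]) simp
  also have "\<dots> \<le> \<rho> * L" using assms by (intro mult_left_mono) auto
  finally show "\<bar>d1 (spectral_jet M a) x y\<bar> \<le> \<rho> * L" "\<bar>d2 (spectral_jet M a) x y\<bar> \<le> \<rho> * L"
    by (simp_all add: spectral_jet_def)
  have "\<bar>\<integral>w. a\<^sup>2 * (w\<^sup>2 * cos (?b * w)) \<partial>M\<bar> \<le> \<rho> * (0 + a\<^sup>2 / 2)"
    by (rule integrable_dominated(2)[OF _ trig_dominated(3)]) simp
  also have "\<dots> \<le> \<rho> * L" using assms by (intro mult_left_mono) auto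
  finally show "\<bar>d12 (spectral_jet M a) x y\<bar> \<le> \<rho> * L" by (simp add: spectral_jet_def)
qed

text \<open>For each frequency the integrand is a sum of two squares: \<open>P\<close> and
  \<open>S\<close> are the operator u_i + v_i d/dt applied to cos(awt) and sin(awt) at t_i, and the
  addition formulas recombine their products.\<close>

lemma psd_spectral_jet:
  fixes t :: "real ^ 'n"
  shows "psd_jet (spectral_jet M a) t"
  unfolding psd_jet_def
proof (intro allI)
  fix u v :: "real ^ 'n"
  define P S where "P = (\<lambda>w i. u $ i * cos (a * w * t $ i) - v $ i * (a * w * sin (a * w * t $ i)))"
    and "S = (\<lambda>w i. u $ i * sin (a * w * t $ i) + v $ i * (a * w * cos (a * w * t $ i)))"
  let ?f = "\<lambda>i j w. u $ i * u $ j * cos (a * (t $ i - t $ j) * w)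
      + u $ i * v $ j * (a * (w * sin (a * (t $ i - t $ j) * w)))
      + v $ i * u $ j * (- (a * (w * sin (a * (t $ i - t $ j) * w))))
      + v $ i * v $ j * (a\<^sup>2 * (w\<^sup>2 * cos (a * (t $ i - t $ j) * w)))"
  have f: "?f i j w = P w i * P w j + S w i * S w j" for i j w
  proof -
    have "a * (t $ i - t $ j) * w = a * w * t $ i - a * w * t $ j" by (simp add: algebra_simps)
    then show ?thesis
      by (simp only: P_def S_def cos_diff sin_diff) (simp add: algebra_simps power2_eq_square)
  qed
  have int: "integrable M (?f i j)" for i j
    by (intro Bochner_Integration.integrable_add integrable_mult_right Bochner_Integration.integrable_minus integrable_trig)
  have "(\<Sum>i\<in>UNIV. \<Sum>j\<in>UNIV.
     u $ i * u $ j * val (spectral_jet M a) (t $ i) (t $ j) + u $ i * v $ j * d2 (spectral_jet M a) (t $ i) (t $ j)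
     + v $ i * u $ j * d1 (spectral_jet M a) (t $ i) (t $ j) + v $ i * v $ j * d12 (spectral_jet M a) (t $ i) (t $ j))
     = (\<Sum>i\<in>UNIV. \<Sum>j\<in>UNIV. \<integral>w. ?f i j w \<partial>M)"
  proof (intro sum.cong refl)
    fix i j
    show "u $ i * u $ j * val (spectral_jet M a) (t $ i) (t $ j) + u $ i * v $ j * d2 (spectral_jet M a) (t $ i) (t $ j)
     + v $ i * u $ j * d1 (spectral_jet M a) (t $ i) (t $ j) + v $ i * v $ j * d12 (spectral_jet M a) (t $ i) (t $ j)
     = (\<integral>w. ?f i j w \<partial>M)"
      unfolding spectral_jet_def jet.simps integral_mult_right_zero[symmetric]
      by (subst Bochner_Integration.integral_add[symmetric],
          (intro Bochner_Integration.integrable_add integrable_mult_right Bochner_Integration.integrable_minus integrable_trig)+)+ (rule refl)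
  qed
  also have "\<dots> = (\<integral>w. (\<Sum>i\<in>UNIV. \<Sum>j\<in>UNIV. ?f i j w) \<partial>M)"
    using int by (simp only: Bochner_Integration.integral_sum Bochner_Integration.integrable_sum)
  also have "\<dots> = (\<integral>w. (\<Sum>i\<in>UNIV. P w i)\<^sup>2 + (\<Sum>i\<in>UNIV. S w i)\<^sup>2 \<partial>M)"
    unfolding f by (simp only: sum.distrib power2_eq_square sum_product)
  also have "0 \<le> \<dots>" by (intro Bochner_Integration.integral_nonneg) simp
  finally show "0 \<le> (\<Sum>i\<in>UNIV. \<Sum>j\<in>UNIV.
     u $ i * u $ j * val (spectral_jet M a) (t $ i) (t $ j) + u $ i * v $ j * d2 (spectral_jet M a) (t $ i) (t $ j)
     + v $ i * u $ j * d1 (spectral_jet M a) (t $ i) (t $ j) + v $ i * v $ j * d12 (spectral_jet M a) (t $ i) (t $ j))" .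
qed

end

section \<open>The two measures, and both jets as spectral jets\<close>

definition gauss_measure :: "real \<Rightarrow> real measure" where
  "gauss_measure \<rho> = density lborel (\<lambda>x. \<rho> / sqrt pi * exp (- x\<^sup>2))"

definition node_measure :: "nat \<Rightarrow> (nat \<Rightarrow> real) \<Rightarrow> (nat \<Rightarrow> real) \<Rightarrow> real \<Rightarrow> real measure" where
  "node_measure m \<omega> W \<rho> = distr (point_measure {..<m} (\<lambda>q. \<rho> / sqrt pi * W q)) borel \<omega>"

lemma integral_gauss_measure:
  fixes f :: "real \<Rightarrow> real"
  assumes "\<rho> > 0" "f \<in> borel_measurable borel"
  shows "(\<integral>w. f w \<partial>gauss_measure \<rho>) = \<rho> / sqrt pi * gint f"
  unfolding gauss_measure_def gint_def integral_mult_right_zero[symmetric]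
  by (subst integral_density) (use assms in \<open>auto simp: mult.assoc\<close>)

lemma integral_node_measure:
  fixes f :: "real \<Rightarrow> real"
  assumes "\<rho> > 0" "gauss_hermite m \<omega> W" "f \<in> borel_measurable borel"
  shows "(\<integral>w. f w \<partial>node_measure m \<omega> W \<rho>) = \<rho> / sqrt pi * (\<Sum>q<m. W q * f (\<omega> q))"
proof -
  have W: "0 \<le> \<rho> / sqrt pi * W q" if "q \<in> {..<m}" for q
    using assms(1,2) that by (simp add: gauss_hermite_def less_imp_le)
  have "(\<integral>w. f w \<partial>node_measure m \<omega> W \<rho>) = (\<integral>q. f (\<omega> q) \<partial>point_measure {..<m} (\<lambda>q. \<rho> / sqrt pi * W q))"
    unfolding node_measure_def by (rule integral_distr[OF _ assms(3)]) simp
  also have "\<dots> = (\<Sum>q<m. (\<rho> / sqrt pi * W q) *\<^sub>R f (\<omega> q))"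
    by (rule lebesgue_integral_point_measure_finite) (use W in auto)
  finally show ?thesis by (simp add: sum_distrib_left mult.assoc)
qed

lemma spectral_measure_gauss:
  assumes "\<rho> > 0" shows "spectral_measure (gauss_measure \<rho>) \<rho>"
proof
  have [simp]: "(\<lambda>x. exp (- x\<^sup>2) * x\<^sup>2) \<in> borel_measurable (borel :: real measure)" by measurable
  show "integrable (gauss_measure \<rho>) (\<lambda>w. 1 :: real)"
    unfolding gauss_measure_def using assms integrable_mult_right[OF gintegrable_power[of 0], of "\<rho> / sqrt pi"]
    by (subst integrable_density) auto
  show "integrable (gauss_measure \<rho>) (\<lambda>w. w\<^sup>2)"
    unfolding gauss_measure_def using assms integrable_mult_right[OF gintegrable_power[of 2], of "\<rho> / sqrt pi"]
    by (subst integrable_density) (auto simp: mult.assoc)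
  show "(\<integral>w. 1 \<partial>gauss_measure \<rho>) = \<rho>" "(\<integral>w. w\<^sup>2 \<partial>gauss_measure \<rho>) = \<rho> / 2"
    by (subst integral_gauss_measure, use assms in \<open>simp_all add: gint_one gint_sq\<close>)+
qed (simp add: gauss_measure_def)

lemma spectral_measure_node:
  assumes "\<rho> > 0" and gh: "gauss_hermite m \<omega> W" and "m \<ge> 2"
  shows "spectral_measure (node_measure m \<omega> W \<rho>) \<rho>"
proof
  have exact: "(\<Sum>q<m. W q * poly p (\<omega> q)) = gint (poly p)" if "degree p < 2 * m" for p
    using gh that unfolding gauss_hermite_def gint_def by (blast intro: has_bochner_integral_integral_eq[symmetric])
  have "(\<Sum>q<m. W q * 1) = sqrt pi"
    using exact[of 1] \<open>m \<ge> 2\<close> by (simp add: poly_1[abs_def] gint_one)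
  then show "(\<integral>w. 1 \<partial>node_measure m \<omega> W \<rho>) = \<rho>"
    by (subst integral_node_measure[OF assms(1,2)]) (use assms in auto)
  have "poly (monom 1 2) = (\<lambda>x::real. x\<^sup>2)" by (simp add: poly_monom fun_eq_iff)
  then have "(\<Sum>q<m. W q * (\<omega> q)\<^sup>2) = sqrt pi / 2"
    using exact[of "monom 1 2"] \<open>m \<ge> 2\<close> by (simp add: gint_sq degree_monom_eq)
  then show "(\<integral>w. w\<^sup>2 \<partial>node_measure m \<omega> W \<rho>) = \<rho> / 2"
    by (subst integral_node_measure[OF assms(1,2)]) (simp, simp only:, simp)
  show "integrable (node_measure m \<omega> W \<rho>) (\<lambda>w. 1 :: real)" "integrable (node_measure m \<omega> W \<rho>) (\<lambda>w. w\<^sup>2)"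
    unfolding node_measure_def
    by (subst integrable_distr_eq; auto simp: integrable_point_measure_finite)+
qed (simp add: node_measure_def)

text \<open>The third clause differentiates the closed form supplied by the second, since the mixed
  derivative in \<open>kernel_jet\<close> has the derivative in y inside.\<close>

lemma rbf_derivs:
  assumes "l > 0"
  shows "deriv (\<lambda>u. rbf \<rho> l u y) x = - (\<rho> * (x - y) / l\<^sup>2 * exp (- (x - y)\<^sup>2 / (2 * l\<^sup>2)))"
    and "deriv (\<lambda>v. rbf \<rho> l x v) y = \<rho> * (x - y) / l\<^sup>2 * exp (- (x - y)\<^sup>2 / (2 * l\<^sup>2))"
    and "deriv (\<lambda>u. \<rho> * (u - y) / l\<^sup>2 * exp (- (u - y)\<^sup>2 / (2 * l\<^sup>2))) x
      = \<rho> * (1 / l\<^sup>2 - (x - y)\<^sup>2 / l ^ 4) * exp (- (x - y)\<^sup>2 / (2 * l\<^sup>2))"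
  unfolding rbf_def
  by (rule DERIV_imp_deriv, (use assms in
      \<open>auto intro!: derivative_eq_intros simp: field_simps power2_eq_square eval_nat_numeral\<close>)[1])+

text \<open>Differentiation under the integral sign is avoided: the derivatives of the kernel and
  the three frequency integrals are evaluated in closed form and compared.\<close>

lemma kernel_jet_rbf:
  assumes "\<rho> > 0" "l > 0"
  shows "kernel_jet (rbf \<rho> l) = spectral_jet (gauss_measure \<rho>) (sqrt 2 / l)"
proof -
  let ?a = "sqrt 2 / l"
  have e: "gint (\<lambda>w. cos (?a * d * w)) = sqrt pi * exp (- d\<^sup>2 / (2 * l\<^sup>2))" for d
    unfolding gint_cos by (simp add: power_mult_distrib power_divide)
  note int = integral_gauss_measure[OF \<open>\<rho> > 0\<close>]
  have "(\<integral>w. cos (?a * d * w) \<partial>gauss_measure \<rho>) = \<rho> * exp (- d\<^sup>2 / (2 * l\<^sup>2))" for d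
    by (subst int) (simp_all only: e, simp_all)
  moreover have "(\<integral>w. ?a * (w * sin (?a * d * w)) \<partial>gauss_measure \<rho>) = \<rho> * d / l\<^sup>2 * exp (- d\<^sup>2 / (2 * l\<^sup>2))" for d
  proof -
    have "(\<integral>w. ?a * (w * sin (?a * d * w)) \<partial>gauss_measure \<rho>)
        = \<rho> / sqrt pi * (?a * (?a * d / 2 * (sqrt pi * exp (- d\<^sup>2 / (2 * l\<^sup>2)))))"
      by (subst int) (simp_all only: gint_cmult gint_mult_sin e, simp)
    also have "\<dots> = \<rho> * (?a * ?a) * d / 2 * exp (- d\<^sup>2 / (2 * l\<^sup>2))"
    proof -
      have "\<rho> / sqrt pi * (c * (c * d / 2 * (sqrt pi * E))) = \<rho> * (c * c) * d / 2 * E" for c E by simp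
      then show ?thesis .
    qed
    also have "?a * ?a = 2 / l\<^sup>2" by (simp add: power2_eq_square)
    finally show ?thesis by simp
  qed
  moreover have "(\<integral>w. ?a\<^sup>2 * (w\<^sup>2 * cos (?a * d * w)) \<partial>gauss_measure \<rho>)
      = \<rho> * (1 / l\<^sup>2 - d\<^sup>2 / l ^ 4) * exp (- d\<^sup>2 / (2 * l\<^sup>2))" for d
  proof -
    have "(\<integral>w. ?a\<^sup>2 * (w\<^sup>2 * cos (?a * d * w)) \<partial>gauss_measure \<rho>)
        = \<rho> / sqrt pi * (?a\<^sup>2 * ((1 / 2 - ?a\<^sup>2 * d\<^sup>2 / 4) * (sqrt pi * exp (- d\<^sup>2 / (2 * l\<^sup>2)))))"
      by (subst int) (simp_all only: gint_cmult gint_sq_mult_cos e power_mult_distrib, simp)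
    also have "\<dots> = \<rho> * (?a\<^sup>2 / 2 - ?a\<^sup>2 * ?a\<^sup>2 * d\<^sup>2 / 4) * exp (- d\<^sup>2 / (2 * l\<^sup>2))"
    proof -
      have "\<rho> / sqrt pi * (c * ((1 / 2 - c * d\<^sup>2 / 4) * (sqrt pi * E))) = \<rho> * (c / 2 - c * c * d\<^sup>2 / 4) * E"
        for c E by (simp add: algebra_simps)
      then show ?thesis .
    qed
    also have "?a\<^sup>2 = 2 / l\<^sup>2" by (simp add: power_divide)
    finally show ?thesis by (simp add: power4_eq_xxxx power2_eq_square)
  qed
  ultimately show ?thesis
    unfolding kernel_jet_def spectral_jet_def integral_minus
    by (simp only: rbf_derivs[OF \<open>l > 0\<close>]) (simp add: rbf_derivs(2)[OF \<open>l > 0\<close>] rbf_def fun_eq_iff)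
qed

lemma sum_lessThan_double:
  fixes f :: "nat \<Rightarrow> 'a::comm_monoid_add"
  shows "(\<Sum>i<2 * m. f i) = (\<Sum>q<m. f (2 * q) + f (2 * q + 1))"
  by (induction m) (simp_all add: add_ac)

lemma feature_jet_qff:
  assumes "\<rho> > 0" and gh: "gauss_hermite m \<omega> W"
  shows "feature_jet (2 * m) (qff \<omega> W \<rho> l) = spectral_jet (node_measure m \<omega> W \<rho>) (sqrt 2 / l)"
proof -
  let ?a = "sqrt 2 / l"
  have W: "W q > 0" if "q < m" for q using gh that by (simp add: gauss_hermite_def)
  define s where "s = sqrt (\<rho> / sqrt pi)"
  have s: "s * s = \<rho> / sqrt pi" using assms by (simp add: s_def)
  have \<phi>: "qff \<omega> W \<rho> l x (2 * q) = s * sqrt (W q) * cos (\<omega> q * ?a * x)"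
    "qff \<omega> W \<rho> l x (2 * q + 1) = s * sqrt (W q) * sin (\<omega> q * ?a * x)" for x q
    by (simp_all add: qff_def s_def)
  have dcos: "deriv (\<lambda>u. A * cos (c * u)) x = - (A * c * sin (c * x))"
    and dsin: "deriv (\<lambda>u. A * sin (c * u)) x = A * c * cos (c * x)" for A c x :: real
    by (auto intro!: DERIV_imp_deriv derivative_eq_intros)
  have \<phi>': "deriv (\<lambda>u. qff \<omega> W \<rho> l u (2 * q)) x = - (s * sqrt (W q) * (\<omega> q * ?a) * sin (\<omega> q * ?a * x))"
    "deriv (\<lambda>u. qff \<omega> W \<rho> l u (2 * q + 1)) x = s * sqrt (W q) * (\<omega> q * ?a) * cos (\<omega> q * ?a * x)" for x q
    unfolding \<phi> by (rule dcos dsin)+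
  have ww: "s * sqrt (W q) * (s * sqrt (W q)) = \<rho> / sqrt pi * W q" if "q < m" for q
    using W[OF that] s by (metis (no_types, opaque_lifting) abs_of_pos mult.assoc mult.left_commute real_sqrt_mult_self)
  \<comment> \<open>The cosine and sine features of one frequency, abstracted to polynomial
    identities: \<open>c1\<close>, \<open>s1\<close> are the values at x, \<open>c2\<close>,
    \<open>s2\<close> those at y, \<open>o'\<close> is the abscissa and \<open>A\<close> the common
    amplitude.\<close>
  have pair: "A * c1 * (A * c2) + A * s1 * (A * s2) = \<kappa> * (w * (c1 * c2 + s1 * s2))"
    "- (A * (o' * a) * s1) * (A * c2) + A * (o' * a) * c1 * (A * s2)
      = \<kappa> * (w * - (a * (o' * (s1 * c2 - c1 * s2))))"
    "A * c1 * - (A * (o' * a) * s2) + A * s1 * (A * (o' * a) * c2)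
      = \<kappa> * (w * (a * (o' * (s1 * c2 - c1 * s2))))"
    "- (A * (o' * a) * s1) * - (A * (o' * a) * s2) + A * (o' * a) * c1 * (A * (o' * a) * c2)
      = \<kappa> * (w * (a\<^sup>2 * (o'\<^sup>2 * (c1 * c2 + s1 * s2))))"
    if "A * A = \<kappa> * w" for A \<kappa> w a o' c1 c2 s1 s2 :: real
    using that by algebra+
  have ang: "?a * (x - y) * \<omega> q = \<omega> q * ?a * x - \<omega> q * ?a * y" for x y q
  proof -
    have "c * (x - y) * w = w * c * x - w * c * y" for c w :: real by (simp add: algebra_simps)
    then show ?thesis .
  qed
  note node = integral_node_measure[OF \<open>\<rho> > 0\<close> gh]
  have "(\<Sum>i<2 * m. qff \<omega> W \<rho> l x i * qff \<omega> W \<rho> l y i)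
      = (\<integral>w. cos (?a * (x - y) * w) \<partial>node_measure m \<omega> W \<rho>)" for x y
    unfolding sum_lessThan_double \<phi>
    by (subst node, simp, unfold sum_distrib_left ang cos_diff, intro sum.cong refl pair(1) ww) simp
  moreover have "(\<Sum>i<2 * m. deriv (\<lambda>u. qff \<omega> W \<rho> l u i) x * qff \<omega> W \<rho> l y i)
      = (\<integral>w. - (?a * (w * sin (?a * (x - y) * w))) \<partial>node_measure m \<omega> W \<rho>)" for x y
    unfolding sum_lessThan_double \<phi>' unfolding \<phi>
    by (subst node, simp, unfold sum_distrib_left ang sin_diff, intro sum.cong refl pair(2) ww) simp
  moreover have "(\<Sum>i<2 * m. qff \<omega> W \<rho> l x i * deriv (\<lambda>u. qff \<omega> W \<rho> l u i) y)
      = (\<integral>w. ?a * (w * sin (?a * (x - y) * w)) \<partial>node_measure m \<omega> W \<rho>)" for x y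
    unfolding sum_lessThan_double \<phi>' unfolding \<phi>
    by (subst node, simp, unfold sum_distrib_left ang sin_diff, intro sum.cong refl pair(3) ww) simp
  moreover have "(\<Sum>i<2 * m. deriv (\<lambda>u. qff \<omega> W \<rho> l u i) x * deriv (\<lambda>u. qff \<omega> W \<rho> l u i) y)
      = (\<integral>w. ?a\<^sup>2 * (w\<^sup>2 * cos (?a * (x - y) * w)) \<partial>node_measure m \<omega> W \<rho>)" for x y
    unfolding sum_lessThan_double \<phi>'
    by (subst node, simp, unfold sum_distrib_left ang cos_diff, intro sum.cong refl pair(4) ww) simp
  ultimately show ?thesis
    by (simp add: feature_jet_def spectral_jet_def fun_eq_iff)
qed

text \<open>All entries are instances of \<open>main\<close>, with prefactor, polynomial and phase
  (1, 1, 0), (a, w, -pi/2) and (a^2, w^2, 0). The restriction on x - y keeps the frequency scale at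
  most a, so that b^2 <= 2L.\<close>

lemma spectral_jet_error:
  assumes "\<rho> > 0" and gh: "gauss_hermite (k + 2) \<omega> W"
    and a: "a > 0" "a\<^sup>2 \<le> 2 * L" "1 \<le> L"
    and xy: "\<bar>x - y\<bar> \<le> 1"
    and e: "e = \<rho> * (2 * (2 * real k + 3) * L ^ (k + 1) * fact k / fact (2 * k))"
  defines "J \<equiv> spectral_jet (gauss_measure \<rho>) a" and "J' \<equiv> spectral_jet (node_measure (k + 2) \<omega> W \<rho>) a"
  shows "\<bar>val J x y - val J' x y\<bar> \<le> e" "\<bar>d1 J x y - d1 J' x y\<bar> \<le> e"
    "\<bar>d2 J x y - d2 J' x y\<bar> \<le> e" "\<bar>d12 J x y - d12 J' x y\<bar> \<le> e"
proof -
  let ?b = "a * (x - y)"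
  let ?E = "(2 * real k + 3) * L ^ k * fact k / fact (2 * k)"
  have b: "?b\<^sup>2 \<le> 2 * L"
  proof -
    have "?b\<^sup>2 \<le> a\<^sup>2 * 1\<^sup>2"
      unfolding power_mult_distrib using xy by (intro mult_left_mono) (auto simp: abs_square_le_1)
    then show ?thesis using a by simp
  qed
  have E0: "?E \<ge> 0" using a by simp
  have e': "e = \<rho> * (2 * L * ?E)" by (simp add: e)
  note ig = integral_gauss_measure[OF \<open>\<rho> > 0\<close>] and "in" = integral_node_measure[OF \<open>\<rho> > 0\<close> gh]
  have main: "\<bar>(\<integral>w. c * (poly \<psi> w * cos (?b * w + \<theta>)) \<partial>gauss_measure \<rho>)
      - (\<integral>w. c * (poly \<psi> w * cos (?b * w + \<theta>)) \<partial>node_measure (k + 2) \<omega> W \<rho>)\<bar> \<le> e"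
    if \<psi>: "degree \<psi> \<le> 2" "\<And>x. \<bar>poly \<psi> x\<bar> \<le> 1 + x\<^sup>2" and c: "\<bar>c\<bar> \<le> 2 * L" for c \<psi> \<theta>
  proof -
    let ?f = "\<lambda>w. poly \<psi> w * cos (?b * w + \<theta>)"
    have [measurable]: "?f \<in> borel_measurable borel"
      by (intro borel_measurable_continuous_onI continuous_intros)
    have "\<bar>(\<integral>w. c * ?f w \<partial>gauss_measure \<rho>) - (\<integral>w. c * ?f w \<partial>node_measure (k + 2) \<omega> W \<rho>)\<bar>
      = \<bar>c\<bar> * (\<rho> / sqrt pi * \<bar>gint ?f - (\<Sum>q<k + 2. W q * ?f (\<omega> q))\<bar>)"
      unfolding integral_mult_right_zero right_diff_distrib[symmetric] ig[OF \<open>?f \<in> _\<close>] "in"[OF \<open>?f \<in> _\<close>]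
      using \<open>\<rho> > 0\<close> by (simp only: abs_mult abs_of_pos divide_pos_pos real_sqrt_gt_zero pi_gt_zero)
    also have "\<dots> \<le> (2 * L) * (\<rho> / sqrt pi * (sqrt pi * ?E))"
      using \<open>\<rho> > 0\<close> c E0
      by (intro mult_mono mult_left_mono gauss_hermite_trig_error[OF gh \<psi> b]) auto
    also have "\<dots> = e" by (simp add: e')
    finally show ?thesis .
  qed
  have sin: "cos (z + - (pi / 2)) = sin z" for z :: real by (simp add: cos_diff)
  \<comment> \<open>A first power of \<open>a\<close> obeys the same bound because 2L >= 1 gives a^2
    <= 2L <= (2L)^2.\<close>
  have aL: "\<bar>a\<bar> \<le> 2 * L"
  proof -
    have "2 * L * 1 \<le> 2 * L * (2 * L)" using a by (intro mult_left_mono) auto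
    then have "a\<^sup>2 \<le> (2 * L)\<^sup>2" using a(2) unfolding power2_eq_square by linarith
    then have "a \<le> 2 * L" by (rule power2_le_imp_le) (use a in simp)
    then show ?thesis using a by simp
  qed
  show "\<bar>val J x y - val J' x y\<bar> \<le> e"
    using main[of 1 1 0] a by (simp add: J_def J'_def spectral_jet_def)
  show d2: "\<bar>d2 J x y - d2 J' x y\<bar> \<le> e"
    using main[of "[:0, 1:]" a "- (pi / 2)"] aL unfolding sin
    by (simp add: J_def J'_def spectral_jet_def abs_le_one_plus_sq del: integral_mult_right_zero)
  then show "\<bar>d1 J x y - d1 J' x y\<bar> \<le> e"
    by (simp add: J_def J'_def spectral_jet_def abs_minus_commute del: integral_mult_right_zero)
  show "\<bar>d12 J x y - d12 J' x y\<bar> \<le> e"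
    using main[of "monom 1 2" "a\<^sup>2" 0] a
    by (simp add: J_def J'_def spectral_jet_def poly_monom degree_monom_eq del: integral_mult_right_zero)
qed

section \<open>Error of the posterior\<close>

text \<open>An elementary substitute for Stirling's formula: since (1 + 1/n)^n <= e, the quotient
  n^n / n! grows at most by the factor e per step, and k steps lead from k to 2k.\<close>

lemma fact_double_ge: "(4 * real k / exp 1) ^ k * fact k \<le> fact (2 * k)"
proof (cases "k = 0")
  case False
  have "real (k + j) ^ (k + j) * fact k \<le> fact (k + j) * (real k ^ k * exp 1 ^ j)" for j
  proof (induction j)
    case (Suc j)
    let ?n = "k + j"
    have n: "real ?n > 0" using False by simp
    have "real (Suc ?n) ^ ?n = real ?n ^ ?n * (1 + 1 / real ?n) ^ ?n"
    proof -
      have "real (Suc ?n) = real ?n * (1 + 1 / real ?n)" using n by (simp add: distrib_left)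
      then show ?thesis by (simp only: power_mult_distrib)
    qed
    also have "\<dots> \<le> real ?n ^ ?n * exp (1 / real ?n) ^ ?n"
      by (intro mult_left_mono power_mono exp_ge_add_one_self) auto
    also have "exp (1 / real ?n) ^ ?n = exp 1"
      using n unfolding exp_of_nat_mult[symmetric] by simp
    finally have "real (Suc ?n) ^ Suc ?n * fact k \<le> real (Suc ?n) * exp 1 * (real ?n ^ ?n * fact k)"
      by (simp add: mult_ac mult_left_mono del: of_nat_Suc)
    also have "\<dots> \<le> real (Suc ?n) * exp 1 * (fact ?n * (real k ^ k * exp 1 ^ j))"
      by (intro mult_left_mono Suc) simp
    finally show ?case by (simp add: mult_ac del: of_nat_Suc)
  qed simp
  from this[of k] have "(2 * real k) ^ (k + k) * fact k \<le> fact (2 * k) * (real k ^ k * exp 1 ^ k)"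
    unfolding mult_2 of_nat_add .
  moreover have "(2 * real k) ^ (k + k) = (4 * real k / exp 1) ^ k * (real k ^ k * exp 1 ^ k)"
  proof -
    have "2 * real k * (2 * real k) = 4 * real k / exp 1 * (real k * exp 1)" by simp
    then show ?thesis by (simp only: power_add power_mult_distrib[symmetric])
  qed
  ultimately have "(real k ^ k * exp 1 ^ k) * ((4 * real k / exp 1) ^ k * fact k) \<le> (real k ^ k * exp 1 ^ k) * fact (2 * k)"
    by (simp only: mult_ac)
  then show ?thesis using False by (subst (asm) mult_le_cancel_left_pos) auto
qed simp

text \<open>With M = eL/2, \<open>fact_double_ge\<close> bounds L^k k!/(2k)! by (M/k)^k / 2^k. As M
  < k, one factor M/k may be kept and the others dropped; its 1/k absorbs the growth of 2k +
  3.\<close>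

lemma quadrature_rate:
  assumes L: "1 \<le> L" and k: "exp 1 * L / 2 + 1 \<le> real k"
  shows "2 * (2 * real k + 3) * L ^ (k + 1) * fact k / fact (2 * k) \<le> 60 * L\<^sup>2 / 2 ^ (k + 2)"
proof -
  define M where "M = exp 1 * L / 2"
  have e: "2 \<le> exp (1::real)" "exp (1::real) \<le> 3"
    using exp_ge_add_one_self[of 1] exp_le by auto
  have M: "1 \<le> M" "M \<le> 3 / 2 * L" "M + 1 \<le> real k"
  proof -
    have "2 * 1 \<le> exp 1 * L" using e L by (intro mult_mono) auto
    then show "1 \<le> M" by (simp add: M_def)
    have "exp 1 * L \<le> 3 * L" using e L by (intro mult_right_mono) auto
    then show "M \<le> 3 / 2 * L" by (simp add: M_def)
  qed (use k in \<open>simp add: M_def\<close>)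
  then have k2: "real k \<ge> 2" by linarith
  have kpos: "k > 0" using k2 by (cases k) auto
  have "L ^ k * fact k * 2 ^ k \<le> (M / real k) ^ k * fact (2 * k)"
  proof -
    have "L ^ k * fact k * 2 ^ k = (M / real k) ^ k * ((4 * real k / exp 1) ^ k * fact k)"
    proof -
      have "L * 2 = M / real k * (4 * real k / exp 1)" using k2 by (simp add: M_def)
      then have "L ^ k * 2 ^ k = (M / real k) ^ k * (4 * real k / exp 1) ^ k"
        by (simp only: power_mult_distrib[symmetric])
      then show ?thesis by (simp only: mult_ac)
    qed
    also have "\<dots> \<le> (M / real k) ^ k * fact (2 * k)"
      using M k2 by (intro mult_left_mono fact_double_ge) auto
    finally show ?thesis .
  qed
  then have "L ^ k * fact k / fact (2 * k) \<le> (M / real k) ^ k / 2 ^ k"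
    by (simp add: pos_divide_le_eq pos_le_divide_eq)
  also have "(M / real k) ^ k \<le> M / real k"
    using M k2 kpos power_decreasing[of 1 k "M / real k"] by simp
  finally have *: "L ^ k * fact k / fact (2 * k) \<le> M / real k / 2 ^ k"
    by (simp add: divide_right_mono)
  have "2 * (2 * real k + 3) * L ^ (k + 1) * fact k / fact (2 * k)
      = 2 * L * (2 * real k + 3) * (L ^ k * fact k / fact (2 * k))" by simp
  also have "\<dots> \<le> 2 * L * (2 * real k + 3) * (M / real k / 2 ^ k)"
    using L by (intro mult_left_mono *) auto
  also have "\<dots> = (2 * L * M) * ((2 * real k + 3) / real k) / 2 ^ k" by simp
  \<comment> \<open>Here e <= 3 gives M <= 3L/2, and (2k + 3)/k <= 5. The resulting 15 becomes 60
    when 2^k is replaced by 2^(k + 2), that is by 2^m.\<close>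
  also have "\<dots> \<le> (2 * L * (3 / 2 * L)) * 5 / 2 ^ k"
    using L M k2 by (intro divide_right_mono mult_mono mult_left_mono) (auto simp: field_simps)
  also have "\<dots> = 60 * L\<^sup>2 / 2 ^ (k + 2)" by (simp add: power2_eq_square)
  finally show ?thesis .
qed

lemma posterior_perturbation:
  fixes t y F :: "real ^ 'n"
  assumes psd: "psd_jet J t" "psd_jet J' t"
    and c: "0 < c" "c \<le> 1" "c \<le> s" "c \<le> \<gamma>"
    and t: "\<And>i. t $ i \<in> {0..1}" and \<tau>: "\<tau> \<in> {0..1}"
    and err: "\<And>x y. x \<in> {0..1} \<Longrightarrow> y \<in> {0..1} \<Longrightarrow> \<bar>val J x y - val J' x y\<bar> \<le> e"
      "\<And>x y. x \<in> {0..1} \<Longrightarrow> y \<in> {0..1} \<Longrightarrow> \<bar>d1 J x y - d1 J' x y\<bar> \<le> e"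
      "\<And>x y. x \<in> {0..1} \<Longrightarrow> y \<in> {0..1} \<Longrightarrow> \<bar>d2 J x y - d2 J' x y\<bar> \<le> e"
      "\<And>x y. x \<in> {0..1} \<Longrightarrow> y \<in> {0..1} \<Longrightarrow> \<bar>d12 J x y - d12 J' x y\<bar> \<le> e"
    and bnd: "\<And>x y. \<bar>val J x y\<bar> \<le> p" "\<And>x y. \<bar>d1 J x y\<bar> \<le> p"
      "\<And>x y. \<bar>d2 J x y\<bar> \<le> p" "\<And>x y. \<bar>d12 J x y\<bar> \<le> p"
      "\<And>x y. \<bar>val J' x y\<bar> \<le> p" "\<And>x y. \<bar>d1 J' x y\<bar> \<le> p"
      "\<And>x y. \<bar>d2 J' x y\<bar> \<le> p" "\<And>x y. \<bar>d12 J' x y\<bar> \<le> p"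
    and p: "1 \<le> p"
    and r: "1 \<le> r" "\<And>i. \<bar>y $ i\<bar> \<le> r" "\<And>i. \<bar>F $ i\<bar> \<le> r"
  shows "e_tot J J' t s \<gamma> y F \<tau> \<le> 9 * (real CARD('n))\<^sup>2 * p\<^sup>2 * r * e / c\<^sup>2"
proof -
  let ?n = "real CARD('n)" and ?A = "K_hat J t s \<gamma>" and ?B = "K_hat J' t s \<gamma>"
  let ?bound = "9 * ?n\<^sup>2 * p\<^sup>2 * r * e / c\<^sup>2"
  have n: "?n \<ge> 1" by (simp add: Suc_le_eq)
  have e0: "e \<ge> 0" using err(1)[of 0 0] by simp
  have N: "real CARD('n + 'n) = 2 * ?n" by simp
  have AB: "\<bar>?A $ i $ j - ?B $ i $ j\<bar> \<le> e" for i j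
    using t by (cases i; cases j) (auto simp: K_hat_def block_mat_def gram_def err)
  note pert = inverse_form_perturbation[OF c(1) K_hat_coercive[OF psd(1) c(3,4)]
    K_hat_coercive[OF psd(2) c(3,4)] AB, unfolded N]
  have k: "\<bar>k_hat J t \<tau> $ i - k_hat J' t \<tau> $ i\<bar> \<le> e" "\<bar>k_hat' J t \<tau> $ i - k_hat' J' t \<tau> $ i\<bar> \<le> e"
    "\<bar>k_hat J t \<tau> $ i\<bar> \<le> p" "\<bar>k_hat' J t \<tau> $ i\<bar> \<le> p"
    "\<bar>k_hat J' t \<tau> $ i\<bar> \<le> p" "\<bar>k_hat' J' t \<tau> $ i\<bar> \<le> p" for i
    using t \<tau> by (cases i; auto simp: k_hat_def k_hat'_def block_vec_def err bnd)+
  have z: "\<bar>block_vec y F $ i\<bar> \<le> r" "\<bar>block_vec y F $ i - block_vec y F $ i\<bar> \<le> 0" for i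
    using r by (cases i; simp add: block_vec_def)+
  have one: "1 \<le> 1 / c" "1 \<le> 1 / c\<^sup>2" "1 / c \<le> 1 / c\<^sup>2"
  proof -
    show *: "1 \<le> 1 / c" using c by simp
    show **: "1 / c \<le> 1 / c\<^sup>2" using c by (simp add: power2_eq_square field_simps)
    show "1 \<le> 1 / c\<^sup>2" using * ** by linarith
  qed
  have pp: "p \<le> p\<^sup>2" "1 \<le> p\<^sup>2" using p by (simp_all add: power2_eq_square mult_ge1_I)
  have nn: "?n \<le> ?n\<^sup>2" "1 \<le> ?n\<^sup>2" using n by (simp_all add: power2_eq_square mult_ge1_I)
  \<comment> \<open>Every error term is padded to one common product, so that only numerical
    coefficients remain to be added.\<close>
  have mono: "a * b * d * e * f \<le> ?n\<^sup>2 * p\<^sup>2 * r * e * (1 / c\<^sup>2)"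
    if "0 \<le> a" "0 \<le> b" "0 \<le> d" "0 \<le> f" "a \<le> ?n\<^sup>2" "b \<le> p\<^sup>2" "d \<le> r" "f \<le> 1 / c\<^sup>2" for a b d f
    using that e0 p r(1) c by (intro mult_mono) auto
  have mean: "2 * ?n * (e * r / c + p * 0 / c) + (2 * ?n)\<^sup>2 * p * e * r / c\<^sup>2 \<le> ?bound"
  proof -
    have "?n * 1 * r * e * (1 / c) \<le> ?n\<^sup>2 * p\<^sup>2 * r * e * (1 / c\<^sup>2)"
      by (rule mono) (use nn pp one r c n in auto)
    moreover have "?n\<^sup>2 * p * r * e * (1 / c\<^sup>2) \<le> ?n\<^sup>2 * p\<^sup>2 * r * e * (1 / c\<^sup>2)"
      by (rule mono) (use nn pp p one r c n in auto)
    moreover have "0 \<le> ?n\<^sup>2 * p\<^sup>2 * r * e * (1 / c\<^sup>2)" using e0 r by simp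
    moreover have "2 * ?n * (e * r / c + p * 0 / c) + (2 * ?n)\<^sup>2 * p * e * r / c\<^sup>2
        = 2 * (?n * 1 * r * e * (1 / c)) + 4 * (?n\<^sup>2 * p * r * e * (1 / c\<^sup>2))"
      by (simp add: power_mult_distrib mult_ac)
    moreover have "?bound = 9 * (?n\<^sup>2 * p\<^sup>2 * r * e * (1 / c\<^sup>2))" by simp
    ultimately show ?thesis by linarith
  qed
  \<comment> \<open>The variance decides the constant: 1 from the prior term, 4 from the two vector
    errors and 4 from the squared dimension (2n)^2, together 9. The mean needs only 2 + 4.\<close>
  have var: "e + (2 * ?n * (e * p / c + p * e / c) + (2 * ?n)\<^sup>2 * p * e * p / c\<^sup>2) \<le> ?bound"
  proof -
    have "1 * 1 * 1 * e * 1 \<le> ?n\<^sup>2 * p\<^sup>2 * r * e * (1 / c\<^sup>2)"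
      by (rule mono) (use nn pp one r c n in auto)
    moreover have "?n * p * 1 * e * (1 / c) \<le> ?n\<^sup>2 * p\<^sup>2 * r * e * (1 / c\<^sup>2)"
      by (rule mono) (use nn pp p one r c n in auto)
    moreover have "?n\<^sup>2 * p\<^sup>2 * 1 * e * (1 / c\<^sup>2) \<le> ?n\<^sup>2 * p\<^sup>2 * r * e * (1 / c\<^sup>2)"
      by (rule mono) (use nn pp p one r c n in auto)
    moreover have "e + (2 * ?n * (e * p / c + p * e / c) + (2 * ?n)\<^sup>2 * p * e * p / c\<^sup>2)
        = 1 * 1 * 1 * e * 1 + 4 * (?n * p * 1 * e * (1 / c)) + 4 * (?n\<^sup>2 * p\<^sup>2 * 1 * e * (1 / c\<^sup>2))"
      by (simp add: power_mult_distrib power2_eq_square[of p] mult_ac)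
    moreover have "?bound = 9 * (?n\<^sup>2 * p\<^sup>2 * r * e * (1 / c\<^sup>2))" by simp
    ultimately show ?thesis by linarith
  qed
  have "\<bar>post_mean J t s \<gamma> y F \<tau> - post_mean J' t s \<gamma> y F \<tau>\<bar> \<le> ?bound"
    unfolding post_mean_def by (rule order_trans[OF pert mean]) (rule k z)+
  moreover have "\<bar>post_mean' J t s \<gamma> y F \<tau> - post_mean' J' t s \<gamma> y F \<tau>\<bar> \<le> ?bound"
    unfolding post_mean'_def by (rule order_trans[OF pert mean]) (rule k z)+
  moreover have "\<bar>post_var J t s \<gamma> \<tau> - post_var J' t s \<gamma> \<tau>\<bar> \<le> ?bound"
    using pert[OF k(1) k(1) k(5) k(3)] err(1)[OF \<tau> \<tau>] var unfolding post_var_def by linarith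
  moreover have "\<bar>post_var' J t s \<gamma> \<tau> - post_var' J' t s \<gamma> \<tau>\<bar> \<le> ?bound"
    using pert[OF k(2) k(2) k(6) k(4)] err(4)[OF \<tau> \<tau>] var unfolding post_var'_def by linarith
  ultimately show ?thesis by (simp add: e_tot_def)
qed

theorem theorem3:
  fixes \<rho> l \<sigma> \<gamma> C :: real
    and t y F :: "real ^ 'n"
    and \<omega> W :: "nat \<Rightarrow> real"
    and m :: nat
  defines "c \<equiv> min \<gamma> (\<sigma>\<^sup>2)"
    and "R \<equiv> max (infnorm y) (infnorm F)"
  defines "\<rho>b \<equiv> max \<rho> 1"
    and "lb \<equiv> min l 1"
    and "cb \<equiv> min c 1"
    and "Rb \<equiv> max R 1"
  assumes "\<rho> > 0" and "l > 0"
    and "\<forall>i. t $ i \<in> {0..1}"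
    and "inj (\<lambda>i. t $ i)"
    and "\<sigma>\<^sup>2 > 0" and "\<gamma> > 0"
    and "C > 0"
    and "gauss_hermite m \<omega> W"
    and "real m \<ge> 3 + max (exp 1 / (2 * lb\<^sup>2))
           (log 2 (270 * (real CARD('n))\<^sup>2 * \<rho>b ^ 3 * Rb / (lb ^ 8 * cb\<^sup>2 * C)))"
  shows "\<forall>\<tau>\<in>{0..1}.
    e_tot (kernel_jet (rbf \<rho> l)) (feature_jet (2 * m) (qff \<omega> W \<rho> l)) t (\<sigma>\<^sup>2) \<gamma> y F \<tau> \<le> C"
proof
  fix \<tau> :: real assume \<tau>: "\<tau> \<in> {0..1}"
  note \<rho> = \<open>\<rho> > 0\<close> and l = \<open>l > 0\<close> and gh = \<open>gauss_hermite m \<omega> W\<close>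
  let ?n = "real CARD('n)"
  define L where "L = 1 / lb\<^sup>2"
  define X where "X = 270 * ?n\<^sup>2 * \<rho>b ^ 3 * Rb / (lb ^ 8 * cb\<^sup>2 * C)"
  have lb: "0 < lb" "lb \<le> 1" "lb \<le> l" using l by (auto simp: lb_def)
  have cb: "0 < cb" "cb \<le> 1" "cb \<le> \<sigma>\<^sup>2" "cb \<le> \<gamma>"
    using \<open>\<sigma>\<^sup>2 > 0\<close> \<open>\<gamma> > 0\<close> by (auto simp: cb_def c_def)
  have \<rho>b: "1 \<le> \<rho>b" "\<rho> \<le> \<rho>b" by (auto simp: \<rho>b_def)
  have Rb: "1 \<le> Rb" "\<bar>y $ i\<bar> \<le> Rb" "\<bar>F $ i\<bar> \<le> Rb" for i
    using component_le_infnorm_cart[of y i] component_le_infnorm_cart[of F i] by (auto simp: Rb_def R_def)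
  have L: "1 \<le> L" using lb by (simp add: L_def power_le_one)
  have X: "0 < X" using \<rho>b Rb lb cb \<open>C > 0\<close> by (simp add: X_def)
  have m: "exp 1 / (2 * lb\<^sup>2) + 3 \<le> real m" "log 2 X + 3 \<le> real m"
    using assms(15) by (auto simp: X_def)
  have "0 < exp 1 / (2 * lb\<^sup>2)" using lb by simp
  then have "m \<ge> 2" using m(1) by linarith
  then obtain k where k: "m = k + 2" by (metis le_add_diff_inverse2)
  have a: "sqrt 2 / l > 0" "(sqrt 2 / l)\<^sup>2 \<le> 2 * L"
  proof -
    have "1 / l\<^sup>2 \<le> 1 / lb\<^sup>2" using lb by (intro divide_left_mono power_mono) auto
    then show "(sqrt 2 / l)\<^sup>2 \<le> 2 * L" by (simp add: power_divide L_def)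
  qed (use l in simp)
  define e where "e = \<rho> * (2 * (2 * real k + 3) * L ^ (k + 1) * fact k / fact (2 * k))"
  \<comment> \<open>Of the summand 3 in the bound on m, two units are lost in k = m - 2 and one
    provides the + 1 demanded by \<open>quadrature_rate\<close>. The logarithmic bound uses the 3
    independently, in \<open>X2\<close>.\<close>
  have "exp 1 * L / 2 + 1 \<le> real k" using m(1) by (simp add: k L_def)
  from quadrature_rate[OF L this] have "e \<le> \<rho> * (60 * L\<^sup>2 / 2 ^ m)"
    unfolding e_def k using \<rho> by (intro mult_left_mono) auto
  also have "\<dots> \<le> \<rho>b * (60 * L\<^sup>2 / 2 ^ m)"
    using \<rho>b by (intro mult_right_mono) auto
  finally have e: "e \<le> \<rho>b * (60 * L\<^sup>2 / 2 ^ m)" .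
  have X2: "8 * X \<le> 2 ^ m"
  proof -
    have "2 powr (log 2 X + 3) \<le> 2 powr real m" using m(2) by simp
    then show ?thesis using X by (simp add: powr_add powr_realpow)
  qed
  interpret g: spectral_measure "gauss_measure \<rho>" \<rho> by (rule spectral_measure_gauss[OF \<rho>])
  interpret q: spectral_measure "node_measure m \<omega> W \<rho>" \<rho> by (rule spectral_measure_node[OF \<rho> gh \<open>m \<ge> 2\<close>])
  have pL: "\<rho> * L \<le> \<rho>b * L" using \<rho>b L by (intro mult_right_mono) auto
  note gb = g.spectral_jet_bound[OF \<rho> a(2) L, THEN order_trans, OF pL]
    and qb = q.spectral_jet_bound[OF \<rho> a(2) L, THEN order_trans, OF pL]
    and err = spectral_jet_error[OF \<rho> gh[unfolded k] a L _ e_def, folded k]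
  let ?J = "spectral_jet (gauss_measure \<rho>) (sqrt 2 / l)"
    and ?J' = "spectral_jet (node_measure m \<omega> W \<rho>) (sqrt 2 / l)"
  have "e_tot (kernel_jet (rbf \<rho> l)) (feature_jet (2 * m) (qff \<omega> W \<rho> l)) t (\<sigma>\<^sup>2) \<gamma> y F \<tau>
      \<le> 9 * ?n\<^sup>2 * (\<rho>b * L)\<^sup>2 * Rb * e / cb\<^sup>2"
    unfolding kernel_jet_rbf[OF \<rho> l] feature_jet_qff[OF \<rho> gh]
  proof (rule posterior_perturbation[OF g.psd_spectral_jet q.psd_spectral_jet cb _ \<tau>])
    show "1 \<le> \<rho>b * L" using \<rho>b L by (simp add: mult_ge1_I)
    fix u v :: real assume "u \<in> {0..1}" "v \<in> {0..1}"
    then have uv: "\<bar>u - v\<bar> \<le> 1" by auto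
    show "\<bar>val ?J u v - val ?J' u v\<bar> \<le> e" "\<bar>d1 ?J u v - d1 ?J' u v\<bar> \<le> e"
      "\<bar>d2 ?J u v - d2 ?J' u v\<bar> \<le> e" "\<bar>d12 ?J u v - d12 ?J' u v\<bar> \<le> e"
      using err[OF uv] by blast+
  qed (rule gb qb Rb assms(9)[rule_format])+
  also have "\<dots> \<le> 9 * ?n\<^sup>2 * (\<rho>b * L)\<^sup>2 * Rb * (\<rho>b * (60 * L\<^sup>2 / 2 ^ m)) / cb\<^sup>2"
    using e Rb by (intro divide_right_mono mult_left_mono) auto
  also have "\<dots> = 2 * C * X / 2 ^ m"
  proof -
    have "X = 270 * ?n\<^sup>2 * \<rho>b ^ 3 * Rb * L ^ 4 / (cb\<^sup>2 * C)"
      by (simp add: X_def L_def power_divide flip: power_mult)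
    then have "C * X = 270 * ?n\<^sup>2 * \<rho>b ^ 3 * Rb * L ^ 4 / cb\<^sup>2"
      using \<open>C > 0\<close> by simp
    moreover have "\<rho>b ^ 3 = \<rho>b\<^sup>2 * \<rho>b" by (simp add: power2_eq_square power3_eq_cube)
    moreover have "L ^ 4 = L\<^sup>2 * L\<^sup>2" by (simp flip: power_add)
    moreover have "9 * N * (b' * z) * r * (b * (60 * z / E)) / D
        = 2 * (270 * N * (b' * b) * r * (z * z) / D) / E" for N b b' r z E D :: real
      by (simp add: mult_ac)
    ultimately show ?thesis by (simp only: mult.assoc[of 2 C X] power_mult_distrib)
  qed
  also have "\<dots> \<le> C"
  proof -
    have "2 * C * X \<le> C * (8 * X)" using X \<open>C > 0\<close> by simp
    also have "\<dots> \<le> C * 2 ^ m" using X2 \<open>C > 0\<close> by (intro mult_left_mono) auto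
    finally show ?thesis by (simp add: field_simps)
  qed
  finally show "e_tot (kernel_jet (rbf \<rho> l)) (feature_jet (2 * m) (qff \<omega> W \<rho> l)) t (\<sigma>\<^sup>2) \<gamma> y F \<tau> \<le> C" .
qed

end
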